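(* Let $\mathcal A$ be a Banach algebra with product $\pi:\mathcal A\times\mathcal A\to\mathcal A$, and let $\pi^*:\mathcal A^*\times\mathcal A\to\mathcal A^*$ be defined by $\langle\pi^*(a^*,a),b\rangle=\langle a^*,\pi(a,b)\rangle$ for $a^*\in\mathcal A^*$, $a,b\in\mathcal A$. In either of the following cases, weak amenability of $(\mathcal A^{**},\Box)$ (first Arens product) implies weak amenability of $\mathcal A$: (i) $\pi^*$ is Arens regular; (ii) every derivation from $\mathcal A$ into $\mathcal A^*$ is weakly compact.
   Context: For a bounded bilinear map $f:\mathcal X\times\mathcal Y\to\mathcal Z$ of normed spaces, the adjoint $f^*:\mathcal Z^*\times\mathcal X\to\mathcal Y^*$ is $\langle f^*(z^*,x),y\rangle=\langle z^*,f(x,y)\rangle$; $f^{**}=(f^* )^*$ and $f^{***}=(f^{**})^*:\mathcal X^{**}\times\mathcal Y^{**}\to\mathcal Z^{**}$. The flip of $f$ is $f^r(y,x)=f(x,y)$. $f$ is Arens regular if $f^{***}=f^{r***r}$; equivalently, for every $x^{**}\in\mathcal X^{**}$ the map $y^{**}\mapsto f^{***}(x^{**},y^{**})$ is $w^*$-$w^*$-continuous from $\mathcal Y^{**}$ to $\mathcal Z^{**}$. The first Arens product on $\mathcal A^{**}$ is $a^{**}\Box b^{**}=\pi^{***}(a^{**},b^{**})$. For a Banach algebra $\mathcal B$, the dual $\mathcal B^*$ is a Banach $\mathcal B$-bimodule via $\langle b\cdot f,c\rangle=\langle f,cb\rangle$ and $\langle f\cdot b,c\rangle=\langle f,bc\rangle$.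 A derivation $D:\mathcal B\to\mathcal B^*$ is a bounded linear map with $D(ab)=D(a)\cdot b+a\cdot D(b)$; it is inner if $D(a)=a\cdot f-f\cdot a$ for some fixed $f\in\mathcal B^*$ and all $a\in\mathcal B$. $\mathcal B$ is weakly amenable if every (bounded) derivation $\mathcal B\to\mathcal B^*$ is inner. *)

theory Defs
  imports "HOL-Analysis.Analysis" "HOL-Library.Function_Algebras"
begin

text \<open>
  The scalar field is a type variable of sort real_normed_field and euclidean_space, so that
  everything applies to both the real and the complex numbers.  Isabelle/HOL has no type of
  bounded functionals that are linear over such a generic field, so a normed space is given by
  a carrier set in an ambient type, and (iterated) dual spaces consist of functions
  between the ambient types.  Addition is that of the ambient type, hence pointwise
  on dual spaces.
\<close>

record ('k, 'v) nspace =
  carrier :: "'v set"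
  smul :: "'k \<Rightarrow> 'v \<Rightarrow> 'v"
  nrm :: "'v \<Rightarrow> real"

record ('k, 'v) nalgebra = "('k, 'v) nspace" +
  mul :: "'v \<Rightarrow> 'v \<Rightarrow> 'v"

definition scalars :: "('k::{real_normed_field, euclidean_space}, 'k) nspace" where
  "scalars = \<lparr>carrier = UNIV, smul = (*), nrm = norm\<rparr>"

definition unit_ball :: "('k, 'v, 'e) nspace_scheme \<Rightarrow> 'v set" where
  "unit_ball X = {x \<in> carrier X. nrm X x \<le> 1}"

definition bdd_linear ::
    "('k, 'v::plus, 'e) nspace_scheme \<Rightarrow> ('k, 'w::plus, 'f) nspace_scheme \<Rightarrow> ('v \<Rightarrow> 'w) \<Rightarrow> bool" where
  "bdd_linear X Y T \<longleftrightarrow>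
     (\<forall>x\<in>carrier X. T x \<in> carrier Y) \<and>
     (\<forall>x\<in>carrier X. \<forall>y\<in>carrier X. T (x + y) = T x + T y) \<and>
     (\<forall>c. \<forall>x\<in>carrier X. T (smul X c x) = smul Y c (T x)) \<and>
     (\<exists>K. \<forall>x\<in>carrier X. nrm Y (T x) \<le> K * nrm X x)"

text \<open>Functionals are set to 0 outside the carrier, so that equality of functionals is
  equality of functions.\<close>

definition dual ::
    "('k::{real_normed_field, euclidean_space}, 'v::plus, 'e) nspace_scheme \<Rightarrow> ('k, 'v \<Rightarrow> 'k) nspace" where
  "dual X =
     \<lparr>carrier = {f. bdd_linear X scalars f \<and> (\<forall>x. x \<notin> carrier X \<longrightarrow> f x = 0)},
      smul = (\<lambda>c f x. c * f x),
      nrm = (\<lambda>f. SUP x\<in>unit_ball X. norm (f x))\<rparr>"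

text \<open>For a bilinear map f from X and Y to Z, arens_adjoint Y f is its adjoint from Z* and X to Y*.
  Only the carrier of Y enters the defining formula.\<close>

definition arens_adjoint ::
    "('k, 'y, 'e) nspace_scheme \<Rightarrow> ('x \<Rightarrow> 'y \<Rightarrow> 'z) \<Rightarrow> (('z \<Rightarrow> 'k) \<Rightarrow> 'x \<Rightarrow> ('y \<Rightarrow> 'k::zero))" where
  "arens_adjoint Y f = (\<lambda>z' x y. if y \<in> carrier Y then z' (f x y) else 0)"

definition triple_adjoint ::
    "('k::{real_normed_field, euclidean_space}, 'x::plus, 'e) nspace_scheme \<Rightarrow>
     ('k, 'y::plus, 'f) nspace_scheme \<Rightarrow> ('k, 'z::plus, 'g) nspace_scheme \<Rightarrow>
     ('x \<Rightarrow> 'y \<Rightarrow> 'z) \<Rightarrow> (('x \<Rightarrow> 'k) \<Rightarrow> 'k) \<Rightarrow> (('y \<Rightarrow> 'k) \<Rightarrow> 'k) \<Rightarrow> (('z \<Rightarrow> 'k) \<Rightarrow> 'k)" where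
  "triple_adjoint X Y Z f = arens_adjoint (dual Z) (arens_adjoint X (arens_adjoint Y f))"

definition flip :: "('x \<Rightarrow> 'y \<Rightarrow> 'z) \<Rightarrow> 'y \<Rightarrow> 'x \<Rightarrow> 'z" where
  "flip f = (\<lambda>y x. f x y)"

definition arens_regular ::
    "('k::{real_normed_field, euclidean_space}, 'x::plus, 'e) nspace_scheme \<Rightarrow>
     ('k, 'y::plus, 'f) nspace_scheme \<Rightarrow> ('k, 'z::plus, 'g) nspace_scheme \<Rightarrow>
     ('x \<Rightarrow> 'y \<Rightarrow> 'z) \<Rightarrow> bool" where
  "arens_regular X Y Z f \<longleftrightarrow>
     (\<forall>\<phi>\<in>carrier (dual (dual X)). \<forall>\<psi>\<in>carrier (dual (dual Y)).
        triple_adjoint X Y Z f \<phi> \<psi> = flip (triple_adjoint Y X Z (flip f)) \<phi> \<psi>)"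

definition bidual_algebra ::
    "('k::{real_normed_field, euclidean_space}, 'v::plus, 'e) nalgebra_scheme \<Rightarrow>
     ('k, ('v \<Rightarrow> 'k) \<Rightarrow> 'k) nalgebra" where
  "bidual_algebra A =
     \<lparr>carrier = carrier (dual (dual A)),
      smul = smul (dual (dual A)),
      nrm = nrm (dual (dual A)),
      mul = triple_adjoint A A A (mul A)\<rparr>"

definition left_act ::
    "('k, 'v, 'e) nalgebra_scheme \<Rightarrow> 'v \<Rightarrow> ('v \<Rightarrow> 'k::zero) \<Rightarrow> ('v \<Rightarrow> 'k)" where
  "left_act B b f = (\<lambda>c. if c \<in> carrier B then f (mul B c b) else 0)"

definition right_act ::
    "('k, 'v, 'e) nalgebra_scheme \<Rightarrow> ('v \<Rightarrow> 'k::zero) \<Rightarrow> 'v \<Rightarrow> ('v \<Rightarrow> 'k)" where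
  "right_act B f b = (\<lambda>c. if c \<in> carrier B then f (mul B b c) else 0)"

definition derivation ::
    "('k::{real_normed_field, euclidean_space}, 'v::plus, 'e) nalgebra_scheme \<Rightarrow>
     ('v \<Rightarrow> ('v \<Rightarrow> 'k)) \<Rightarrow> bool" where
  "derivation B D \<longleftrightarrow>
     bdd_linear B (dual B) D \<and>
     (\<forall>a\<in>carrier B. \<forall>b\<in>carrier B.
        D (mul B a b) = right_act B (D a) b + left_act B a (D b))"

definition inner_derivation ::
    "('k::{real_normed_field, euclidean_space}, 'v::plus, 'e) nalgebra_scheme \<Rightarrow>
     ('v \<Rightarrow> ('v \<Rightarrow> 'k)) \<Rightarrow> bool" where
  "inner_derivation B D \<longleftrightarrow>
     (\<exists>f\<in>carrier (dual B). \<forall>a\<in>carrier B. D a = left_act B a f - right_act B f a)"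

definition weakly_amenable ::
    "('k::{real_normed_field, euclidean_space}, 'v::plus, 'e) nalgebra_scheme \<Rightarrow> bool" where
  "weakly_amenable B \<longleftrightarrow> (\<forall>D. derivation B D \<longrightarrow> inner_derivation B D)"

definition weak_topology ::
    "('k::{real_normed_field, euclidean_space}, 'v::plus, 'e) nspace_scheme \<Rightarrow> 'v topology" where
  "weak_topology X =
     topology_generated_by {{x \<in> carrier X. \<phi> x \<in> U} | \<phi> U. \<phi> \<in> carrier (dual X) \<and> open U}"

definition weakly_compact ::
    "('k, 'v, 'e) nspace_scheme \<Rightarrow>
     ('k::{real_normed_field, euclidean_space}, 'w::plus, 'f) nspace_scheme \<Rightarrow> ('v \<Rightarrow> 'w) \<Rightarrow> bool" where
  "weakly_compact X Y T \<longleftrightarrow>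
     compactin (weak_topology Y) (weak_topology Y closure_of (T ` unit_ball X))"

text \<open>A Banach algebra over the field 'k: the norm, completeness and the product come from the
  type classes, and only the scalar multiplication by 'k is an additional parameter.  The assumption
  of_real_scl follows from the others (additivity and continuity in the scalar).\<close>

locale banach_algebra = vector_space scl
  for scl :: "'k::{real_normed_field, euclidean_space} \<Rightarrow> 'a::{real_normed_algebra, banach} \<Rightarrow> 'a" +
  assumes norm_scl: "norm (scl c x) = norm c * norm x"
    and scl_mult_left: "scl c x * y = scl c (x * y)"
    and scl_mult_right: "x * scl c y = scl c (x * y)"
    and of_real_scl: "scl (of_real r) x = r *\<^sub>R x"

definition algebra_of ::
    "('k::{real_normed_field, euclidean_space} \<Rightarrow> 'a::{real_normed_algebra, banach} \<Rightarrow> 'a) \<Rightarrow>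
     ('k, 'a) nalgebra" where
  "algebra_of scl = \<lparr>carrier = UNIV, smul = scl, nrm = norm, mul = (*)\<rparr>"

lemma banach_algebra_scaleR:
  "banach_algebra (scaleR :: real \<Rightarrow> 'a::{real_normed_algebra, banach} \<Rightarrow> 'a)"
  by unfold_locales (auto simp: algebra_simps)

lemma banach_algebra_complex: "banach_algebra ((*) :: complex \<Rightarrow> complex \<Rightarrow> complex)"
  by unfold_locales (auto simp: algebra_simps norm_mult scaleR_conv_of_real)

lemma dual_scaleR:
  "carrier (dual (algebra_of (scaleR :: real \<Rightarrow> 'a::{real_normed_algebra, banach} \<Rightarrow> 'a))) =
     {f. bounded_linear f}"
  by (auto simp: dual_def algebra_of_def bdd_linear_def scalars_def mult.commute
      bounded_linear_def bounded_linear_axioms_def linear_iff)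

end

theory Submission
  imports Defs
begin

text \<open>
  Write \<open>\<phi>\<^sub>a f(a)\<close> for the value of \<open>\<phi>\<close> at the functional \<open>a \<mapsto> f(a)\<close>, so that
  \<open>\<phi>\<box>\<psi>\<close> sends \<open>f\<close> to \<open>\<phi>\<^sub>a \<psi>\<^sub>b f(ab)\<close>.  For a derivation \<open>D\<close> into the dual, the second adjoint
  \<open>D''(\<phi>)(\<xi>) = \<phi>\<^sub>a \<xi>(D a)\<close> is a derivation on the bidual as soon as
  \<open>\<phi>\<^sub>a \<psi>\<^sub>b \<xi>\<^sub>c (D b)(ca) = \<psi>\<^sub>b \<xi>\<^sub>c \<phi>\<^sub>a (D b)(ca)\<close>; and if a functional \<open>F\<close> implements \<open>D''\<close>, then the
  restriction of \<open>F\<close> to the algebra implements \<open>D\<close>.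

  If \<open>D\<close> is weakly compact, then \<open>\<phi>\<^sub>a \<xi>(D a) = \<xi>\<^sub>c \<phi>\<^sub>a (D a)(c)\<close> by Helly's theorem, and the identity
  follows from \<open>(D b)(ca) = D(ab)(c) - (D a)(bc)\<close>.

  If the adjoint of the product is Arens regular, then \<open>\<psi> \<mapsto> \<Lambda>(\<psi>\<box>\<omega>)\<close> is weak*-continuous for
  every \<open>\<Lambda>\<close> in the third dual.  Regularity alone does not seem to give the identity.  But a
  functional on a weakly amenable algebra that vanishes on all products is zero, so it suffices
  to check the identity for \<open>\<phi> = x\<omega>\<close> with \<open>x\<close> in the algebra, where the limits can be interchanged
  one at a time; the same argument first shows that the algebra itself is Arens regular.
\<close>

section \<open>Dual spaces\<close>

text \<open>An interface that is stable under passing to the dual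
  (\<open>normed_space_on_dual\<close>), so that the same facts serve the algebra, its dual and its
  bidual.\<close>

locale normed_space_on =
  fixes X :: "('k::{real_normed_field, euclidean_space}, 'v::plus, 'e) nspace_scheme"
  assumes carrier_nonempty: "carrier X \<noteq> {}"
    and add_closed: "x \<in> carrier X \<Longrightarrow> y \<in> carrier X \<Longrightarrow> x + y \<in> carrier X"
    and smul_closed: "x \<in> carrier X \<Longrightarrow> smul X c x \<in> carrier X"
    and nrm_nonneg: "x \<in> carrier X \<Longrightarrow> 0 \<le> nrm X x"
    and nrm_smul: "x \<in> carrier X \<Longrightarrow> nrm X (smul X c x) = norm c * nrm X x"
    and smul_smul: "x \<in> carrier X \<Longrightarrow> smul X c (smul X d x) = smul X (c * d) x"
    and smul_one: "x \<in> carrier X \<Longrightarrow> smul X 1 x = x"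

text \<open>Truncation by 0 matches the convention for functionals in \<open>dual\<close>; it turns
  a formula meaningful on the carrier into an actual element of the dual.\<close>

definition restr :: "('k, 'v, 'e) nspace_scheme \<Rightarrow> ('v \<Rightarrow> 'w::zero) \<Rightarrow> 'v \<Rightarrow> 'w" where
  "restr X h = (\<lambda>x. if x \<in> carrier X then h x else 0)"

lemma restr_apply: "x \<in> carrier X \<Longrightarrow> restr X h x = h x"
  by (simp add: restr_def)

lemma dual_sel:
  "smul (dual X) = (\<lambda>c f x. c * f x)"
  "nrm (dual X) = (\<lambda>f. SUP x\<in>unit_ball X. norm (f x))"
  by (simp_all add: dual_def)

lemma dualI:
  fixes X :: "('k::{real_normed_field, euclidean_space}, 'v::plus, 'e) nspace_scheme"
  assumes "\<And>x y. x \<in> carrier X \<Longrightarrow> y \<in> carrier X \<Longrightarrow> f (x + y) = f x + f y"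
    and "\<And>c x. x \<in> carrier X \<Longrightarrow> f (smul X c x) = c * f x"
    and "\<And>x. x \<in> carrier X \<Longrightarrow> norm (f x) \<le> K * nrm X x"
    and "\<And>x. x \<notin> carrier X \<Longrightarrow> f x = 0"
  shows "f \<in> carrier (dual X)"
proof -
  have "\<exists>K. \<forall>x\<in>carrier X. norm (f x) \<le> K * nrm X x" using assms(3) by blast
  then show ?thesis using assms(1,2,4) by (auto simp: dual_def bdd_linear_def scalars_def)
qed

lemma dual_add: "f \<in> carrier (dual X) \<Longrightarrow> x \<in> carrier X \<Longrightarrow> y \<in> carrier X \<Longrightarrow> f (x + y) = f x + f y"
  and dual_smul: "f \<in> carrier (dual X) \<Longrightarrow> x \<in> carrier X \<Longrightarrow> f (smul X c x) = c * f x"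
  and dual_outside: "f \<in> carrier (dual X) \<Longrightarrow> x \<notin> carrier X \<Longrightarrow> f x = 0"
  by (auto simp: dual_def bdd_linear_def scalars_def)

lemma dual_ext:
  assumes "f \<in> carrier (dual X)" "g \<in> carrier (dual X)" "\<And>x. x \<in> carrier X \<Longrightarrow> f x = g x"
  shows "f = g"
  using assms dual_outside by (metis ext)

context normed_space_on
begin

lemma unit_ball_nonempty: "unit_ball X \<noteq> {}"
proof -
  obtain x where "x \<in> carrier X" using carrier_nonempty by blast
  then have "smul X 0 x \<in> unit_ball X"
    by (simp add: unit_ball_def smul_closed nrm_smul)
  then show ?thesis by blast
qed

lemma restr_dualI:
  assumes "\<And>x y. x \<in> carrier X \<Longrightarrow> y \<in> carrier X \<Longrightarrow> h (x + y) = h x + h y"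
    and "\<And>c x. x \<in> carrier X \<Longrightarrow> h (smul X c x) = c * h x"
    and "\<And>x. x \<in> carrier X \<Longrightarrow> norm (h x) \<le> K * nrm X x"
  shows "restr X h \<in> carrier (dual X)"
  by (rule dualI[where K=K]) (simp_all add: restr_def assms add_closed smul_closed)

lemma dual_bound:
  assumes "f \<in> carrier (dual X)"
  obtains K where "0 \<le> K" "\<And>x. x \<in> carrier X \<Longrightarrow> norm (f x) \<le> K * nrm X x"
proof -
  have "\<exists>K. \<forall>x\<in>carrier X. norm (f x) \<le> K * nrm X x"
    using assms by (simp add: dual_def bdd_linear_def scalars_def)
  then obtain K where K: "\<And>x. x \<in> carrier X \<Longrightarrow> norm (f x) \<le> K * nrm X x" by blast
  show thesis
  proof (rule that[of "\<bar>K\<bar>"])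
    fix x assume x: "x \<in> carrier X"
    show "norm (f x) \<le> \<bar>K\<bar> * nrm X x"
      using K[OF x] mult_right_mono[OF abs_ge_self nrm_nonneg[OF x], of K] by linarith
  qed simp
qed

lemma nrm_dual_le:
  assumes "0 \<le> K" "\<And>x. x \<in> carrier X \<Longrightarrow> norm (f x) \<le> K * nrm X x"
  shows "nrm (dual X) f \<le> K"
  unfolding dual_sel
proof (rule cSUP_least[OF unit_ball_nonempty])
  fix x assume "x \<in> unit_ball X"
  then have x: "x \<in> carrier X" "nrm X x \<le> 1" by (auto simp: unit_ball_def)
  show "norm (f x) \<le> K"
    using assms(2)[OF x(1)] mult_left_mono[OF x(2) assms(1)] by simp
qed

lemma bdd_above_unit_ball:
  assumes "f \<in> carrier (dual X)"
  shows "bdd_above ((\<lambda>x. norm (f x)) ` unit_ball X)"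
proof -
  obtain K where K: "0 \<le> K" "\<And>x. x \<in> carrier X \<Longrightarrow> norm (f x) \<le> K * nrm X x"
    using dual_bound[OF assms] by blast
  show ?thesis
  proof (rule bdd_aboveI2)
    fix x assume "x \<in> unit_ball X"
    then have x: "x \<in> carrier X" "nrm X x \<le> 1" by (auto simp: unit_ball_def)
    show "norm (f x) \<le> K"
      using K(2)[OF x(1)] mult_left_mono[OF x(2) K(1)] by simp
  qed
qed

lemma nrm_dual_nonneg:
  assumes "f \<in> carrier (dual X)"
  shows "0 \<le> nrm (dual X) f"
proof -
  obtain x where x: "x \<in> unit_ball X" using unit_ball_nonempty by blast
  have "norm (f x) \<le> nrm (dual X) f"
    unfolding dual_sel by (rule cSUP_upper[OF x bdd_above_unit_ball[OF assms]])
  then show ?thesis using norm_ge_zero[of "f x"] by linarith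
qed

lemma norm_le_nrm_dual:
  assumes "f \<in> carrier (dual X)" "x \<in> carrier X"
  shows "norm (f x) \<le> nrm (dual X) f * nrm X x"
proof (cases "nrm X x = 0")
  case True
  \<comment> \<open>A vector of norm 0 cannot be normalised; here any bound of \<open>f\<close>
    already forces \<open>f x = 0\<close>.\<close>
  obtain K where "norm (f x) \<le> K * nrm X x"
    using dual_bound[OF assms(1)] assms(2) by blast
  then show ?thesis using True by simp
next
  case False
  define r where "r = nrm X x"
  have r: "r > 0" using False nrm_nonneg[OF assms(2)] by (simp add: r_def)
  define u where "u = smul X (inverse (of_real r)) x"
  have u: "u \<in> unit_ball X"
    using r by (simp add: u_def unit_ball_def smul_closed assms(2) nrm_smul norm_inverse r_def)
  have "norm (f u) \<le> nrm (dual X) f"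
    unfolding dual_sel by (rule cSUP_upper[OF u bdd_above_unit_ball[OF assms(1)]])
  moreover have "norm (f u) = norm (f x) / r"
    using r by (simp add: u_def dual_smul[OF assms] norm_mult norm_inverse divide_inverse mult.commute)
  ultimately show ?thesis using r by (simp add: field_simps r_def)
qed

lemma zero_mem_dual: "(\<lambda>_. 0) \<in> carrier (dual X)"
  by (rule dualI[where K=0]) simp_all

lemma add_mem_dual:
  assumes f: "f \<in> carrier (dual X)" and g: "g \<in> carrier (dual X)"
  shows "(\<lambda>x. f x + g x) \<in> carrier (dual X)"
proof (rule dualI[where K="nrm (dual X) f + nrm (dual X) g"])
  fix x assume x: "x \<in> carrier X"
  show "norm (f x + g x) \<le> (nrm (dual X) f + nrm (dual X) g) * nrm X x"
    using norm_triangle_ineq[of "f x" "g x"] norm_le_nrm_dual[OF f x] norm_le_nrm_dual[OF g x]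
    by (simp add: algebra_simps)
qed (simp_all add: dual_add[OF f] dual_add[OF g] dual_smul[OF f] dual_smul[OF g]
    dual_outside[OF f] dual_outside[OF g] algebra_simps)

lemma scale_mem_dual:
  assumes f: "f \<in> carrier (dual X)"
  shows "(\<lambda>x. c * f x) \<in> carrier (dual X)"
proof (rule dualI[where K="norm c * nrm (dual X) f"])
  fix x assume x: "x \<in> carrier X"
  show "norm (c * f x) \<le> norm c * nrm (dual X) f * nrm X x"
    using mult_left_mono[OF norm_le_nrm_dual[OF f x], of "norm c"] by (simp add: norm_mult mult.assoc)
qed (simp_all add: dual_add[OF f] dual_smul[OF f] dual_outside[OF f] algebra_simps)

lemma diff_mem_dual:
  assumes f: "f \<in> carrier (dual X)" and g: "g \<in> carrier (dual X)"
  shows "(\<lambda>x. f x - g x) \<in> carrier (dual X)"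
  using add_mem_dual[OF f scale_mem_dual[OF g, of "-1"]] by simp

lemma nrm_dual_smul:
  assumes f: "f \<in> carrier (dual X)"
  shows "nrm (dual X) (smul (dual X) c f) = norm c * nrm (dual X) f"
proof -
  have le: "nrm (dual X) (\<lambda>x. c * f x) \<le> norm c * nrm (dual X) f"
    if f: "f \<in> carrier (dual X)" for c f
  proof (rule nrm_dual_le)
    fix x assume x: "x \<in> carrier X"
    show "norm (c * f x) \<le> norm c * nrm (dual X) f * nrm X x"
      using mult_left_mono[OF norm_le_nrm_dual[OF f x], of "norm c"] by (simp add: norm_mult mult.assoc)
  qed (simp add: nrm_dual_nonneg[OF f])
  show ?thesis
  proof (cases "c = 0")
    case True
    then show ?thesis
      using le[OF f, of 0] nrm_dual_nonneg[OF zero_mem_dual] by (simp add: dual_sel(1))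
  next
    case False
    \<comment> \<open>The reverse inequality is \<open>le\<close> for the scalar
      \<open>inverse c\<close> and the functional c f.\<close>
    have "nrm (dual X) (\<lambda>x. inverse c * (c * f x)) \<le> norm (inverse c) * nrm (dual X) (\<lambda>x. c * f x)"
      by (rule le[OF scale_mem_dual[OF f]])
    moreover have "(\<lambda>x. inverse c * (c * f x)) = f" using False by auto
    ultimately have "norm c * nrm (dual X) f \<le> nrm (dual X) (\<lambda>x. c * f x)"
      using False by (simp add: norm_divide field_simps)
    with le[OF f, of c] show ?thesis by (simp add: dual_sel(1))
  qed
qed

lemma normed_space_on_dual: "normed_space_on (dual X)"
proof
  show "carrier (dual X) \<noteq> {}" using zero_mem_dual by blast
  show "f + g \<in> carrier (dual X)" if "f \<in> carrier (dual X)" "g \<in> carrier (dual X)" for f g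
    using add_mem_dual[OF that] by (simp add: plus_fun_def)
  show "smul (dual X) c f \<in> carrier (dual X)" if "f \<in> carrier (dual X)" for c f
    using scale_mem_dual[OF that] by (simp add: dual_sel)
qed (simp_all add: nrm_dual_nonneg nrm_dual_smul, simp_all add: dual_sel(1) mult.assoc)

lemma sum_mem_dual:
  assumes "\<And>i. i \<in> F \<Longrightarrow> f i \<in> carrier (dual X)"
  shows "(\<lambda>x. \<Sum>i\<in>F. f i x) \<in> carrier (dual X)"
  using assms
  by (induction F rule: infinite_finite_induct) (auto intro: zero_mem_dual add_mem_dual)

lemma bidual_zero:
  assumes "\<phi> \<in> carrier (dual (dual X))"
  shows "\<phi> (\<lambda>_. 0) = 0"
  using dual_smul[OF assms zero_mem_dual, of 0] by (simp add: dual_sel(1))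

lemma bidual_add:
  assumes "\<phi> \<in> carrier (dual (dual X))" "f \<in> carrier (dual X)" "g \<in> carrier (dual X)"
  shows "\<phi> (\<lambda>x. f x + g x) = \<phi> f + \<phi> g"
  using dual_add[OF assms] by (simp add: plus_fun_def)

lemma bidual_scale:
  assumes "\<phi> \<in> carrier (dual (dual X))" "f \<in> carrier (dual X)"
  shows "\<phi> (\<lambda>x. c * f x) = c * \<phi> f"
  using dual_smul[OF assms] by (simp add: dual_sel(1))

lemma bidual_diff:
  assumes "\<phi> \<in> carrier (dual (dual X))" "f \<in> carrier (dual X)" "g \<in> carrier (dual X)"
  shows "\<phi> (\<lambda>x. f x - g x) = \<phi> f - \<phi> g"
  using bidual_add[OF assms(1,2) scale_mem_dual[OF assms(3), of "-1"]]
    bidual_scale[OF assms(1,3), of "-1"] by simp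

lemma bidual_sum:
  assumes "\<phi> \<in> carrier (dual (dual X))" "\<And>i. i \<in> F \<Longrightarrow> f i \<in> carrier (dual X)"
  shows "\<phi> (\<lambda>x. \<Sum>i\<in>F. f i x) = (\<Sum>i\<in>F. \<phi> (f i))"
  using assms(2)
  by (induction F rule: infinite_finite_induct)
    (auto simp: bidual_zero[OF assms(1)] bidual_add[OF assms(1)] sum_mem_dual)

text \<open>The canonical embedding into the bidual.\<close>

definition evaluation :: "'v \<Rightarrow> ('v \<Rightarrow> 'k) \<Rightarrow> 'k" where
  "evaluation x = restr (dual X) (\<lambda>f. f x)"

lemma evaluation_apply: "f \<in> carrier (dual X) \<Longrightarrow> evaluation x f = f x"
  by (simp add: evaluation_def restr_apply)

lemma evaluation_mem:
  assumes "x \<in> carrier X"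
  shows "evaluation x \<in> carrier (dual (dual X))"
  unfolding evaluation_def
proof (rule normed_space_on.restr_dualI[OF normed_space_on_dual, where K="nrm X x"])
  fix f assume "f \<in> carrier (dual X)"
  from norm_le_nrm_dual[OF this assms] show "norm (f x) \<le> nrm X x * nrm (dual X) f"
    by (simp add: mult.commute)
qed (simp_all add: dual_sel(1))

end

text \<open>\<open>\<phi> \<mapsto> \<Lambda>(\<phi>)\<Lambda>\<close> is a derivation, and an inner derivation \<open>D\<close> has \<open>D(\<phi>)(\<phi>) = 0\<close>.\<close>

lemma weakly_amenable_functional_eq_0:
  fixes B :: "('k::{real_normed_field, euclidean_space}, 'v::plus, 'e) nalgebra_scheme"
  assumes B: "normed_space_on B"
    and closed: "\<And>\<phi> \<psi>. \<phi> \<in> carrier B \<Longrightarrow> \<psi> \<in> carrier B \<Longrightarrow> mul B \<phi> \<psi> \<in> carrier B"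
    and wa: "weakly_amenable B" and L: "\<Lambda> \<in> carrier (dual B)"
    and products: "\<And>\<phi> \<psi>. \<phi> \<in> carrier B \<Longrightarrow> \<psi> \<in> carrier B \<Longrightarrow> \<Lambda> (mul B \<phi> \<psi>) = 0"
    and \<phi>: "\<phi> \<in> carrier B"
  shows "\<Lambda> \<phi> = 0"
proof -
  interpret normed_space_on B by (rule B)
  define D where "D = (\<lambda>\<phi>. smul (dual B) (\<Lambda> \<phi>) \<Lambda>)"
  have "derivation B D"
    unfolding derivation_def bdd_linear_def
  proof (intro conjI ballI allI exI)
    fix x y c assume x: "x \<in> carrier B" 
    show "D x \<in> carrier (dual B)"
      using scale_mem_dual[OF L] by (simp add: D_def dual_sel(1))
    show "D (smul B c x) = smul (dual B) c (D x)"
      by (simp add: D_def dual_smul[OF L x] dual_sel(1) mult.assoc)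
    show "nrm (dual B) (D x) \<le> nrm (dual B) \<Lambda> * nrm (dual B) \<Lambda> * nrm B x"
      using mult_right_mono[OF norm_le_nrm_dual[OF L x] nrm_dual_nonneg[OF L]]
      by (simp add: D_def nrm_dual_smul[OF L] mult_ac)
    assume y: "y \<in> carrier B"
    show "D (x + y) = D x + D y"
      by (simp add: D_def dual_add[OF L x y] dual_sel(1) fun_eq_iff distrib_right)
    \<comment> \<open>All three terms vanish: each contains \<Lambda> evaluated at a
      product.\<close>
    show "D (mul B x y) = right_act B (D x) y + left_act B x (D y)"
      by (simp add: D_def products x y dual_sel(1) fun_eq_iff right_act_def left_act_def)
  qed
  then obtain F where "\<And>\<psi>. \<psi> \<in> carrier B \<Longrightarrow> D \<psi> = left_act B \<psi> F - right_act B F \<psi>"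
    using wa by (auto simp: weakly_amenable_def inner_derivation_def)
  \<comment> \<open>Both module actions evaluate \<open>F\<close> at the square of \<phi> and
    cancel, which leaves the square of \<Lambda>(\<phi>) equal to 0.\<close>
  then have "D \<phi> \<phi> = 0" using \<phi> by (simp add: left_act_def right_act_def)
  then show ?thesis by (simp add: D_def dual_sel(1))
qed

text \<open>Over the reals \<open>z \<mapsto> z \<bullet> 1\<close> is the identity, over the complex numbers it is the real part.\<close>

lemma inner_one_represents:
  fixes v :: "'k::{real_normed_field, euclidean_space}"
  obtains w where "\<And>z. (w * z) \<bullet> 1 = v \<bullet> z"
proof -
  \<comment> \<open>\<open>M w\<close> is the vector representing the real-linear functional z
    \<mapsto> (w z) \<bullet> 1 with respect to the inner product.\<close>
  define M where "M = (\<lambda>w::'k. \<Sum>b\<in>Basis. ((w * b) \<bullet> 1) *\<^sub>R b)"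
  have lin: "linear M"
    by (rule linearI)
      (simp_all add: M_def distrib_right inner_add_left scaleR_add_left sum.distrib
        scaleR_sum_right mult.assoc)
  have inner_M: "M w \<bullet> z = (w * z) \<bullet> 1" for w z
  proof -
    have "M w \<bullet> z = (\<Sum>b\<in>Basis. ((z \<bullet> b) *\<^sub>R (w * b)) \<bullet> 1)"
      unfolding M_def inner_sum_left by (rule sum.cong) (simp_all add: inner_commute[of z] mult.commute)
    also have "\<dots> = (w * (\<Sum>b\<in>Basis. (z \<bullet> b) *\<^sub>R b)) \<bullet> 1"
      by (simp add: sum_distrib_left inner_sum_left)
    finally show ?thesis by (simp only: euclidean_representation)
  qed
  \<comment> \<open>Testing at \<open>inverse w\<close> shows that the kernel is trivial; in finite
    dimension \<open>M\<close> is then onto, so every real-linear functional has this form.\<close>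
  have "inj M"
  proof (subst linear_injective_0[OF lin], intro allI impI)
    fix w assume "M w = 0"
    then have "(w * inverse w) \<bullet> 1 = 0" using inner_M[of w "inverse w"] by simp
    then show "w = 0" by (cases "w = 0") simp_all
  qed
  with lin have "surj M" by (simp add: linear_injective_imp_surjective)
  then obtain w where "v = M w" by (meson surjD)
  then show thesis using that inner_M by simp
qed

section \<open>Multilinear forms and the first Arens product\<close>

context banach_algebra
begin

abbreviation A where "A \<equiv> algebra_of scl"
abbreviation A' where "A' \<equiv> dual A"
abbreviation A'' where "A'' \<equiv> dual A'"
abbreviation A''' where "A''' \<equiv> dual A''"

lemma algebra_sel [simp]:
  "carrier A = UNIV" "smul A = scl" "nrm A = norm" "mul A = (*)"
  by (simp_all add: algebra_of_def)

lemma normed_space_on_algebra: "normed_space_on A"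
  by unfold_locales (simp_all add: norm_scl)

interpretation sp: normed_space_on A by (rule normed_space_on_algebra)
interpretation dl: normed_space_on A' by (rule sp.normed_space_on_dual)
interpretation bd: normed_space_on A'' by (rule dl.normed_space_on_dual)

section \<open>Bounded bilinear and trilinear forms, and their contraction with elements of the
  bidual\<close>

lemma functionalI:
  assumes "\<And>x y. f (x + y) = f x + f y" "\<And>c x. f (scl c x) = c * f x" "\<And>x. norm (f x) \<le> K * norm x"
  shows "f \<in> carrier A'"
  by (rule dualI[where K=K]) (simp_all add: assms)

lemma functional_add: "f \<in> carrier A' \<Longrightarrow> f (x + y) = f x + f y"
  and functional_scl: "f \<in> carrier A' \<Longrightarrow> f (scl c x) = c * f x"
  and functional_le: "f \<in> carrier A' \<Longrightarrow> norm (f x) \<le> nrm A' f * norm x"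
  using dual_add[of f A x y] dual_smul[of f A x c] sp.norm_le_nrm_dual[of f x] by simp_all

text \<open>Every iterated limit below is a contraction of such forms. Elements of the bidual may be
  applied only to functionals in the carrier, and the contraction lemmas supply these memberships
  one variable at a time.\<close>

definition bilinear_form :: "('a \<Rightarrow> 'a \<Rightarrow> 'k) \<Rightarrow> bool" where
  "bilinear_form u \<longleftrightarrow> (\<forall>b. u b \<in> carrier A') \<and> (\<forall>c. (\<lambda>b. u b c) \<in> carrier A') \<and>
     (\<exists>K\<ge>0. \<forall>b c. norm (u b c) \<le> K * norm b * norm c)"

definition trilinear_form :: "('a \<Rightarrow> 'a \<Rightarrow> 'a \<Rightarrow> 'k) \<Rightarrow> bool" where
  "trilinear_form t \<longleftrightarrow> (\<forall>b. bilinear_form (t b)) \<and> (\<forall>c. bilinear_form (\<lambda>b. t b c)) \<and>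
     (\<forall>a. bilinear_form (\<lambda>b c. t b c a)) \<and>
     (\<exists>K\<ge>0. \<forall>b c a. norm (t b c a) \<le> K * norm b * norm c * norm a)"

lemma bilinear_formD:
  assumes "bilinear_form u"
  shows "u b \<in> carrier A'" "(\<lambda>b. u b c) \<in> carrier A'"
  using assms by (auto simp: bilinear_form_def)

lemma bilinear_form_bound:
  assumes "bilinear_form u"
  obtains K where "0 \<le> K" "\<And>b c. norm (u b c) \<le> K * norm b * norm c"
  using assms by (auto simp: bilinear_form_def)

lemma trilinear_form_bound:
  assumes "trilinear_form t"
  obtains K where "0 \<le> K" "\<And>b c a. norm (t b c a) \<le> K * norm b * norm c * norm a"
  using assms by (auto simp: trilinear_form_def)

lemma bilinear_flip:
  assumes u: "bilinear_form u"
  shows "bilinear_form (\<lambda>b c. u c b)"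
proof -
  obtain K where K: "0 \<le> K" "\<And>b c. norm (u b c) \<le> K * norm b * norm c"
    using bilinear_form_bound[OF u] by blast
  have "norm (u c b) \<le> K * norm b * norm c" for b c
    using K(2)[of c b] by (simp add: mult_ac)
  then show ?thesis
    using bilinear_formD[OF u] K(1) unfolding bilinear_form_def by blast
qed

text \<open>Together with \<open>trilinear_flip_outer\<close> this generates all permutations of the
  three arguments.\<close>

lemma trilinear_flip_inner:
  assumes t: "trilinear_form t"
  shows "trilinear_form (\<lambda>b c a. t b a c)"
proof -
  obtain K where K: "0 \<le> K" "\<And>b c a. norm (t b c a) \<le> K * norm b * norm c * norm a"
    using trilinear_form_bound[OF t] by blast
  have "norm (t b a c) \<le> K * norm b * norm c * norm a" for b c a
    using K(2)[of b a c] by (simp add: mult_ac)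
  then show ?thesis
    using t bilinear_flip K(1) unfolding trilinear_form_def by blast
qed

lemma trilinear_flip_outer:
  assumes t: "trilinear_form t"
  shows "trilinear_form (\<lambda>b c a. t a c b)"
proof -
  obtain K where K: "0 \<le> K" "\<And>b c a. norm (t b c a) \<le> K * norm b * norm c * norm a"
    using trilinear_form_bound[OF t] by blast
  have "norm (t a c b) \<le> K * norm b * norm c * norm a" for b c a
    using K(2)[of a c b] by (simp add: mult_ac)
  then show ?thesis
    using t bilinear_flip K(1) unfolding trilinear_form_def by blast
qed

lemma norm_bidual_apply_le:
  assumes "\<psi> \<in> carrier A''" "f \<in> carrier A'" "0 \<le> K" "\<And>x. norm (f x) \<le> K * norm x"
  shows "norm (\<psi> f) \<le> nrm A'' \<psi> * K"
proof -
  have "nrm A' f \<le> K" using sp.nrm_dual_le[of K f] assms(3,4) by simp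
  then show ?thesis
    using dl.norm_le_nrm_dual[OF assms(1,2)] dl.nrm_dual_nonneg[OF assms(1)] mult_left_mono
    by (meson order_trans)
qed

lemma norm_bilinear_contract_le:
  assumes u: "bilinear_form u" and \<psi>: "\<psi> \<in> carrier A''"
    and K: "0 \<le> K" "\<And>b c. norm (u b c) \<le> K * norm b * norm c"
  shows "norm (\<psi> (u b)) \<le> nrm A'' \<psi> * K * norm b"
  using norm_bidual_apply_le[OF \<psi> bilinear_formD(1)[OF u], of "K * norm b"] K
  by (simp add: mult.assoc)

lemma bilinear_contract:
  assumes u: "bilinear_form u" and \<psi>: "\<psi> \<in> carrier A''"
  shows "(\<lambda>b. \<psi> (u b)) \<in> carrier A'"
proof -
  obtain K where K: "0 \<le> K" "\<And>b c. norm (u b c) \<le> K * norm b * norm c"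
    using bilinear_form_bound[OF u] by blast
  show ?thesis
  proof (rule functionalI)
    fix x y
    have "u (x + y) = (\<lambda>c. u x c + u y c)"
      using functional_add[OF bilinear_formD(2)[OF u]] by blast
    then show "\<psi> (u (x + y)) = \<psi> (u x) + \<psi> (u y)"
      using sp.bidual_add[OF \<psi> bilinear_formD(1)[OF u] bilinear_formD(1)[OF u]] by simp
  next
    fix c x
    have "u (scl c x) = (\<lambda>z. c * u x z)"
      using functional_scl[OF bilinear_formD(2)[OF u]] by blast
    then show "\<psi> (u (scl c x)) = c * \<psi> (u x)"
      using sp.bidual_scale[OF \<psi> bilinear_formD(1)[OF u]] by simp
  next
    show "norm (\<psi> (u x)) \<le> nrm A'' \<psi> * K * norm x" for x
      by (rule norm_bilinear_contract_le[OF u \<psi> K])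
  qed
qed

lemma trilinear_contract:
  assumes t: "trilinear_form t" and \<phi>: "\<phi> \<in> carrier A''"
  shows "bilinear_form (\<lambda>b c. \<phi> (t b c))"
proof -
  obtain K where K: "0 \<le> K" "\<And>b c a. norm (t b c a) \<le> K * norm b * norm c * norm a"
    using trilinear_form_bound[OF t] by blast
  have 1: "bilinear_form (t b)" "bilinear_form (\<lambda>b. t b c)" for b c
    using t by (auto simp: trilinear_form_def)
  have "norm (\<phi> (t b c)) \<le> nrm A'' \<phi> * K * norm b * norm c" for b c
    using norm_bilinear_contract_le[OF 1(1)[of b] \<phi>, of "K * norm b" c] K
    by (simp add: mult.assoc)
  moreover have "0 \<le> nrm A'' \<phi> * K" using K(1) dl.nrm_dual_nonneg[OF \<phi>] by simp
  ultimately show ?thesis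
    using bilinear_contract[OF 1(1) \<phi>] bilinear_contract[OF 1(2) \<phi>]
    unfolding bilinear_form_def by blast
qed

lemma functional_mul_right:
  assumes f: "f \<in> carrier A'"
  shows "(\<lambda>a. f (a * x)) \<in> carrier A'"
proof (rule functionalI[where K="nrm A' f * norm x"])
  fix a
  have "norm (f (a * x)) \<le> nrm A' f * norm (a * x)" by (rule functional_le[OF f])
  also have "\<dots> \<le> nrm A' f * (norm a * norm x)"
    by (rule mult_left_mono[OF norm_mult_ineq sp.nrm_dual_nonneg[OF f]])
  finally show "norm (f (a * x)) \<le> nrm A' f * norm x * norm a" by (simp add: mult_ac)
qed (simp_all add: distrib_right functional_add[OF f] scl_mult_left functional_scl[OF f])

lemma functional_mul_left:
  assumes f: "f \<in> carrier A'"
  shows "(\<lambda>a. f (x * a)) \<in> carrier A'"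
proof (rule functionalI[where K="nrm A' f * norm x"])
  fix a
  have "norm (f (x * a)) \<le> nrm A' f * norm (x * a)" by (rule functional_le[OF f])
  also have "\<dots> \<le> nrm A' f * (norm x * norm a)"
    by (rule mult_left_mono[OF norm_mult_ineq sp.nrm_dual_nonneg[OF f]])
  finally show "norm (f (x * a)) \<le> nrm A' f * norm x * norm a" by (simp add: mult_ac)
qed (simp_all add: distrib_left functional_add[OF f] scl_mult_right functional_scl[OF f])

lemma norm_functional_mul_le:
  assumes f: "f \<in> carrier A'"
  shows "norm (f (a * b)) \<le> nrm A' f * norm a * norm b"
  using functional_le[OF f, of "a * b"]
    mult_left_mono[OF norm_mult_ineq[of a b] sp.nrm_dual_nonneg[OF f]]
  by (simp add: mult.assoc)

lemma bilinear_mul: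
  assumes f: "f \<in> carrier A'"
  shows "bilinear_form (\<lambda>a b. f (a * b))"
  using functional_mul_left[OF f] functional_mul_right[OF f] sp.nrm_dual_nonneg[OF f]
    norm_functional_mul_le[OF f]
  unfolding bilinear_form_def by blast

lemma bilinear_mul_right:
  assumes u: "bilinear_form u"
  shows "bilinear_form (\<lambda>b c. u b (c * x))"
proof -
  obtain K where K: "0 \<le> K" "\<And>b c. norm (u b c) \<le> K * norm b * norm c"
    using bilinear_form_bound[OF u] by blast
  have "norm (u b (c * x)) \<le> K * norm x * norm b * norm c" for b c
    using K(2)[of b "c * x"] mult_left_mono[OF norm_mult_ineq[of c x], of "K * norm b"] K(1)
    by (simp add: mult_ac)
  moreover have "0 \<le> K * norm x" using K(1) by simp
  ultimately show ?thesis
    using functional_mul_right[OF bilinear_formD(1)[OF u]] bilinear_formD(2)[OF u]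
    unfolding bilinear_form_def by blast
qed

lemma bilinear_mul_left:
  assumes u: "bilinear_form u"
  shows "bilinear_form (\<lambda>b c. u b (x * c))"
proof -
  obtain K where K: "0 \<le> K" "\<And>b c. norm (u b c) \<le> K * norm b * norm c"
    using bilinear_form_bound[OF u] by blast
  have "norm (u b (x * c)) \<le> K * norm x * norm b * norm c" for b c
    using K(2)[of b "x * c"] mult_left_mono[OF norm_mult_ineq[of x c], of "K * norm b"] K(1)
    by (simp add: mult_ac)
  moreover have "0 \<le> K * norm x" using K(1) by simp
  ultimately show ?thesis
    using functional_mul_left[OF bilinear_formD(1)[OF u]] bilinear_formD(2)[OF u]
    unfolding bilinear_form_def by blast
qed

lemma trilinear_mul:
  assumes u: "bilinear_form u"
  shows "trilinear_form (\<lambda>b c a. u b (c * a))"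
proof -
  obtain K where K: "0 \<le> K" "\<And>b c. norm (u b c) \<le> K * norm b * norm c"
    using bilinear_form_bound[OF u] by blast
  have "norm (u b (c * a)) \<le> K * norm b * norm c * norm a" for b c a
    using K(2)[of b "c * a"] mult_left_mono[OF norm_mult_ineq[of c a], of "K * norm b"] K(1)
    by (simp add: mult_ac)
  then show ?thesis
    using bilinear_mul[OF bilinear_formD(1)[OF u]] bilinear_mul_left[OF u] bilinear_mul_right[OF u] K(1)
    unfolding trilinear_form_def by blast
qed

section \<open>The first Arens product and functionals on the bidual\<close>

definition arens :: "(('a \<Rightarrow> 'k) \<Rightarrow> 'k) \<Rightarrow> (('a \<Rightarrow> 'k) \<Rightarrow> 'k) \<Rightarrow> ('a \<Rightarrow> 'k) \<Rightarrow> 'k" where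
  "arens \<phi> \<psi> = restr A' (\<lambda>f. \<phi> (\<lambda>a. \<psi> (\<lambda>b. f (a * b))))"

lemma arens_apply: "f \<in> carrier A' \<Longrightarrow> arens \<phi> \<psi> f = \<phi> (\<lambda>a. \<psi> (\<lambda>b. f (a * b)))"
  by (simp add: arens_def restr_apply)

text \<open>Unfolding the three adjoints produces exactly \<phi>_a \<psi>_b f(ab), so the product of
  the bidual can be handled through this iterated formula.\<close>

lemma bidual_sel [simp]:
  "carrier (bidual_algebra A) = carrier A''" "smul (bidual_algebra A) = smul A''"
  "nrm (bidual_algebra A) = nrm A''" "mul (bidual_algebra A) = arens"
  by (auto simp: bidual_algebra_def triple_adjoint_def arens_adjoint_def arens_def restr_def fun_eq_iff)

lemma dual_bidual_algebra: "dual (bidual_algebra A) = A'''"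
  by (simp add: dual_def bdd_linear_def unit_ball_def)

text \<open>Stated for a general \<open>m\<close> so as to cover both the product and the product
  with its factors exchanged, which yields the second Arens product.\<close>

lemma iterated_bidual_mem:
  assumes m: "\<And>f. f \<in> carrier A' \<Longrightarrow> bilinear_form (\<lambda>a b. f (m a b))"
    and le: "\<And>f a b. f \<in> carrier A' \<Longrightarrow> norm (f (m a b)) \<le> nrm A' f * norm a * norm b"
    and \<phi>: "\<phi> \<in> carrier A''" and \<psi>: "\<psi> \<in> carrier A''"
  shows "restr A' (\<lambda>f. \<phi> (\<lambda>a. \<psi> (\<lambda>b. f (m a b)))) \<in> carrier A''"
proof (rule dl.restr_dualI)
  note h = bilinear_contract[OF m \<psi>] and m1 = bilinear_formD(1)[OF m]
  fix f g assume f: "f \<in> carrier A'" and g: "g \<in> carrier A'"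
  have "\<psi> (\<lambda>b. (f + g) (m a b)) = \<psi> (\<lambda>b. f (m a b)) + \<psi> (\<lambda>b. g (m a b))" for a
    using sp.bidual_add[OF \<psi> m1[OF f] m1[OF g]] by simp
  then show "\<phi> (\<lambda>a. \<psi> (\<lambda>b. (f + g) (m a b))) =
      \<phi> (\<lambda>a. \<psi> (\<lambda>b. f (m a b))) + \<phi> (\<lambda>a. \<psi> (\<lambda>b. g (m a b)))"
    using sp.bidual_add[OF \<phi> h[OF f] h[OF g]] by simp
next
  note h = bilinear_contract[OF m \<psi>] and m1 = bilinear_formD(1)[OF m]
  fix c f assume f: "f \<in> carrier A'"
  show "\<phi> (\<lambda>a. \<psi> (\<lambda>b. smul A' c f (m a b))) = c * \<phi> (\<lambda>a. \<psi> (\<lambda>b. f (m a b)))"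
    using sp.bidual_scale[OF \<phi> h[OF f]]
    by (simp add: dual_sel(1) sp.bidual_scale[OF \<psi> m1[OF f]])
next
  fix f assume f: "f \<in> carrier A'"
  have 0: "0 \<le> nrm A' f" by (rule sp.nrm_dual_nonneg[OF f])
  have "norm (\<phi> (\<lambda>a. \<psi> (\<lambda>b. f (m a b)))) \<le> nrm A'' \<phi> * (nrm A'' \<psi> * nrm A' f)"
    using dl.nrm_dual_nonneg[OF \<psi>] 0 norm_bilinear_contract_le[OF m[OF f] \<psi> 0 le[OF f]]
    by (intro norm_bidual_apply_le[OF \<phi> bilinear_contract[OF m[OF f] \<psi>]]) simp_all
  then show "norm (\<phi> (\<lambda>a. \<psi> (\<lambda>b. f (m a b)))) \<le> nrm A'' \<phi> * nrm A'' \<psi> * nrm A' f"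
    by (simp add: mult.assoc)
qed

lemma arens_mem: "\<phi> \<in> carrier A'' \<Longrightarrow> \<psi> \<in> carrier A'' \<Longrightarrow> arens \<phi> \<psi> \<in> carrier A''"
  unfolding arens_def by (rule iterated_bidual_mem[OF bilinear_mul norm_functional_mul_le])

text \<open>This functional is the image of \<phi> under the second adjoint of b \<mapsto> u b. Such
  elements of the third dual are the ones on which regularity gets tested.\<close>

lemma bidual_nested_mem:
  assumes u: "bilinear_form u" and \<phi>: "\<phi> \<in> carrier A''"
  shows "restr A'' (\<lambda>\<omega>. \<phi> (\<lambda>b. \<omega> (u b))) \<in> carrier A'''"
proof -
  obtain K where K: "0 \<le> K" "\<And>b c. norm (u b c) \<le> K * norm b * norm c"
    using bilinear_form_bound[OF u] by blast
  show ?thesis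
  proof (rule bd.restr_dualI)
    fix \<omega> \<omega>' assume w: "\<omega> \<in> carrier A''" "\<omega>' \<in> carrier A''"
    show "\<phi> (\<lambda>b. (\<omega> + \<omega>') (u b)) = \<phi> (\<lambda>b. \<omega> (u b)) + \<phi> (\<lambda>b. \<omega>' (u b))"
      using sp.bidual_add[OF \<phi> bilinear_contract[OF u w(1)] bilinear_contract[OF u w(2)]] by simp
  next
    fix c \<omega> assume w: "\<omega> \<in> carrier A''"
    show "\<phi> (\<lambda>b. smul A'' c \<omega> (u b)) = c * \<phi> (\<lambda>b. \<omega> (u b))"
      using sp.bidual_scale[OF \<phi> bilinear_contract[OF u w]] by (simp add: dual_sel(1))
  next
    fix \<omega> assume w: "\<omega> \<in> carrier A''"
    have "norm (\<phi> (\<lambda>b. \<omega> (u b))) \<le> nrm A'' \<phi> * (nrm A'' \<omega> * K)"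
      using norm_bilinear_contract_le[OF u w K] K(1) dl.nrm_dual_nonneg[OF w]
      by (intro norm_bidual_apply_le[OF \<phi> bilinear_contract[OF u w]]) simp_all
    then show "norm (\<phi> (\<lambda>b. \<omega> (u b))) \<le> nrm A'' \<phi> * K * nrm A'' \<omega>"
      by (simp add: mult_ac)
  qed
qed

lemma bidual_nested2_mem:
  assumes t: "trilinear_form t" and \<phi>: "\<phi> \<in> carrier A''" and \<psi>: "\<psi> \<in> carrier A''"
  shows "restr A'' (\<lambda>\<omega>. \<phi> (\<lambda>b. \<psi> (\<lambda>c. \<omega> (t b c)))) \<in> carrier A'''"
proof -
  obtain K where K: "0 \<le> K" "\<And>b c a. norm (t b c a) \<le> K * norm b * norm c * norm a"
    using trilinear_form_bound[OF t] by blast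
  note t2 = trilinear_contract[OF t]
  note h = bilinear_contract[OF t2 \<psi>]
  show ?thesis
  proof (rule bd.restr_dualI)
    fix \<omega> \<omega>' assume w: "\<omega> \<in> carrier A''" "\<omega>' \<in> carrier A''"
    have "\<psi> (\<lambda>c. (\<omega> + \<omega>') (t b c)) = \<psi> (\<lambda>c. \<omega> (t b c)) + \<psi> (\<lambda>c. \<omega>' (t b c))" for b
      using sp.bidual_add[OF \<psi> bilinear_formD(1)[OF t2[OF w(1)]] bilinear_formD(1)[OF t2[OF w(2)]]]
      by simp
    then show "\<phi> (\<lambda>b. \<psi> (\<lambda>c. (\<omega> + \<omega>') (t b c))) =
        \<phi> (\<lambda>b. \<psi> (\<lambda>c. \<omega> (t b c))) + \<phi> (\<lambda>b. \<psi> (\<lambda>c. \<omega>' (t b c)))"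
      using sp.bidual_add[OF \<phi> h[OF w(1)] h[OF w(2)]] by simp
  next
    fix c \<omega> assume w: "\<omega> \<in> carrier A''"
    have "\<psi> (\<lambda>z. smul A'' c \<omega> (t b z)) = c * \<psi> (\<lambda>z. \<omega> (t b z))" for b
      using sp.bidual_scale[OF \<psi> bilinear_formD(1)[OF t2[OF w]]] by (simp add: dual_sel(1))
    then show "\<phi> (\<lambda>b. \<psi> (\<lambda>z. smul A'' c \<omega> (t b z))) = c * \<phi> (\<lambda>b. \<psi> (\<lambda>z. \<omega> (t b z)))"
      using sp.bidual_scale[OF \<phi> h[OF w]] by simp
  next
    fix \<omega> assume w: "\<omega> \<in> carrier A''"
    have t1: "bilinear_form (t b)" for b using t by (simp add: trilinear_form_def)
    have 1: "norm (\<omega> (t b c)) \<le> nrm A'' \<omega> * K * norm b * norm c" for b c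
      using norm_bilinear_contract_le[OF t1 w, of "K * norm b"] K by (simp add: mult.assoc)
    have 0: "0 \<le> nrm A'' \<omega> * K" using K(1) dl.nrm_dual_nonneg[OF w] by simp
    have "norm (\<phi> (\<lambda>b. \<psi> (\<lambda>c. \<omega> (t b c)))) \<le> nrm A'' \<phi> * (nrm A'' \<psi> * (nrm A'' \<omega> * K))"
      using norm_bilinear_contract_le[OF t2[OF w] \<psi> 0 1] 0 dl.nrm_dual_nonneg[OF \<psi>]
      by (intro norm_bidual_apply_le[OF \<phi> h[OF w]]) simp_all
    then show "norm (\<phi> (\<lambda>b. \<psi> (\<lambda>c. \<omega> (t b c)))) \<le> nrm A'' \<phi> * nrm A'' \<psi> * K * nrm A'' \<omega>"
      by (simp add: mult_ac)
  qed
qed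

lemma evaluation_algebra_mem: "sp.evaluation x \<in> carrier A''"
  by (rule sp.evaluation_mem) simp

lemma arens_evaluation_left:
  "\<psi> \<in> carrier A'' \<Longrightarrow> f \<in> carrier A' \<Longrightarrow> arens (sp.evaluation x) \<psi> f = \<psi> (\<lambda>b. f (x * b))"
  using sp.evaluation_apply[OF bilinear_contract[OF bilinear_mul]] by (simp add: arens_apply)

lemma arens_evaluation_right:
  "f \<in> carrier A' \<Longrightarrow> arens \<phi> (sp.evaluation x) f = \<phi> (\<lambda>a. f (a * x))"
  by (simp add: arens_apply sp.evaluation_apply functional_mul_left)

lemma arens_evaluation: "arens (sp.evaluation x) (sp.evaluation y) = sp.evaluation (x * y)"
  by (rule dual_ext[where X=A'])
    (simp_all add: arens_mem evaluation_algebra_mem arens_evaluation_left sp.evaluation_apply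
      functional_mul_left)

section \<open>The second adjoint of a derivation\<close>

lemma derivation_bilinear:
  assumes "derivation A D"
  shows "bilinear_form D"
proof -
  have D: "D b \<in> carrier A'" "D (b + c) = D b + D c" "D (scl k b) = smul A' k (D b)" for b c k
    using assms by (auto simp: derivation_def bdd_linear_def)
  obtain K where K: "\<And>b. nrm A' (D b) \<le> K * norm b"
    using assms by (auto simp: derivation_def bdd_linear_def)
  have le: "norm (D b c) \<le> \<bar>K\<bar> * norm b * norm c" for b c
  proof -
    have "nrm A' (D b) \<le> \<bar>K\<bar> * norm b"
      using K[of b] mult_right_mono[OF abs_ge_self norm_ge_zero, of K b] by linarith
    then show ?thesis
      using functional_le[OF D(1), of b c] mult_right_mono[OF _ norm_ge_zero[of c]]
      by (meson order_trans)
  qed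
  have "(\<lambda>b. D b c) \<in> carrier A'" for c
    using le[of _ c]
    by (intro functionalI[where K="\<bar>K\<bar> * norm c"]) (simp_all add: D dual_sel(1) mult_ac)
  then show ?thesis unfolding bilinear_form_def using D(1) le by (metis abs_ge_zero)
qed

lemma derivation_mul:
  assumes "derivation A D"
  shows "D (a * b) c = D a (b * c) + D b (c * a)"
  using assms by (simp add: derivation_def right_act_def left_act_def)

definition second_adjoint ::
    "('a \<Rightarrow> 'a \<Rightarrow> 'k) \<Rightarrow> (('a \<Rightarrow> 'k) \<Rightarrow> 'k) \<Rightarrow> ((('a \<Rightarrow> 'k) \<Rightarrow> 'k) \<Rightarrow> 'k)" where
  "second_adjoint D \<phi> = restr A'' (\<lambda>\<xi>. \<phi> (\<lambda>a. \<xi> (D a)))"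

lemma bdd_linear_second_adjoint:
  assumes D: "bilinear_form D"
  shows "bdd_linear (bidual_algebra A) A''' (second_adjoint D)"
proof -
  obtain K where K: "0 \<le> K" "\<And>b c. norm (D b c) \<le> K * norm b * norm c"
    using bilinear_form_bound[OF D] by blast
  have "nrm A''' (second_adjoint D \<phi>) \<le> K * nrm A'' \<phi>" if \<phi>: "\<phi> \<in> carrier A''" for \<phi>
  proof (rule bd.nrm_dual_le)
    show "0 \<le> K * nrm A'' \<phi>" using K(1) dl.nrm_dual_nonneg[OF \<phi>] by simp
    fix \<xi> assume \<xi>: "\<xi> \<in> carrier A''"
    have "norm (\<phi> (\<lambda>a. \<xi> (D a))) \<le> nrm A'' \<phi> * (nrm A'' \<xi> * K)"
      using norm_bilinear_contract_le[OF D \<xi> K] K(1) dl.nrm_dual_nonneg[OF \<xi>]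
      by (intro norm_bidual_apply_le[OF \<phi> bilinear_contract[OF D \<xi>]]) simp_all
    then show "norm (second_adjoint D \<phi> \<xi>) \<le> K * nrm A'' \<phi> * nrm A'' \<xi>"
      using \<xi> by (simp add: second_adjoint_def restr_apply mult_ac)
  qed
  moreover have "second_adjoint D \<phi> \<in> carrier A'''" if "\<phi> \<in> carrier A''" for \<phi>
    unfolding second_adjoint_def by (rule bidual_nested_mem[OF D that])
  ultimately show ?thesis
    unfolding bdd_linear_def bidual_sel
    by (auto simp: second_adjoint_def restr_def dual_sel(1) fun_eq_iff)
qed

text \<open>The iterated limits on the two sides of this identity differ only in the position of
  \<open>\<phi>\<close>: it is the obstruction to the second adjoint being a derivation.\<close>

definition limits_interchange :: "('a \<Rightarrow> 'a \<Rightarrow> 'k) \<Rightarrow> bool" where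
  "limits_interchange D \<longleftrightarrow> (\<forall>\<phi>\<in>carrier A''. \<forall>\<psi>\<in>carrier A''. \<forall>\<xi>\<in>carrier A''.
     \<phi> (\<lambda>a. \<psi> (\<lambda>b. \<xi> (\<lambda>c. D b (c * a)))) = \<psi> (\<lambda>b. \<xi> (\<lambda>c. \<phi> (\<lambda>a. D b (c * a)))))"

text \<open>At \<xi>, the Leibniz rule splits the value on \<phi>\<box>\<psi> into \<phi>_a \<psi>_b
  \<xi>_c of (D a)(bc) and of (D b)(ca). The first part is D''(\<phi>)(\<psi>\<box>\<xi>) as it
  stands; the second has to become D''(\<psi>)(\<xi>\<box>\<phi>), where \<phi> is innermost, and
  this is the interchange of limits.\<close>

lemma derivation_second_adjoint:
  assumes D: "derivation A D" and lim: "limits_interchange D"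
  shows "derivation (bidual_algebra A) (second_adjoint D)"
  unfolding derivation_def dual_bidual_algebra bidual_sel
proof (intro conjI ballI)
  note bil = derivation_bilinear[OF D]
  show "bdd_linear (bidual_algebra A) A''' (second_adjoint D)"
    by (rule bdd_linear_second_adjoint[OF bil])
  fix \<phi> \<psi> assume \<phi>: "\<phi> \<in> carrier A''" and \<psi>: "\<psi> \<in> carrier A''"
  have tri: "trilinear_form (\<lambda>b c a. D b (c * a))" by (rule trilinear_mul[OF bil])
  have "second_adjoint D (arens \<phi> \<psi>) \<xi> =
      second_adjoint D \<phi> (arens \<psi> \<xi>) + second_adjoint D \<psi> (arens \<xi> \<phi>)"
    if \<xi>: "\<xi> \<in> carrier A''" for \<xi>
  proof -
    have 1: "bilinear_form (\<lambda>a b. \<xi> (\<lambda>c. D a (b * c)))"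
      by (rule trilinear_contract[OF tri \<xi>])
    have 2: "bilinear_form (\<lambda>a b. \<xi> (\<lambda>c. D b (c * a)))"
      by (rule trilinear_contract[OF trilinear_flip_inner[OF trilinear_flip_outer[OF tri]] \<xi>])
    have "\<xi> (D (a * b)) = \<xi> (\<lambda>c. D a (b * c)) + \<xi> (\<lambda>c. D b (c * a))" for a b
    proof -
      have "D (a * b) = (\<lambda>c. D a (b * c) + D b (c * a))" using derivation_mul[OF D] by blast
      then show ?thesis
        using sp.bidual_add[OF \<xi> functional_mul_left[OF bilinear_formD(1)[OF bil]]
            functional_mul_right[OF bilinear_formD(1)[OF bil]]] by simp
    qed
    then have "second_adjoint D (arens \<phi> \<psi>) \<xi> =
        \<phi> (\<lambda>a. \<psi> (\<lambda>b. \<xi> (\<lambda>c. D a (b * c)) + \<xi> (\<lambda>c. D b (c * a))))"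
      using \<xi> by (simp add: second_adjoint_def restr_apply arens_apply bilinear_contract[OF bil \<xi>])
    also have "\<dots> = \<phi> (\<lambda>a. \<psi> (\<lambda>b. \<xi> (\<lambda>c. D a (b * c)))) + \<phi> (\<lambda>a. \<psi> (\<lambda>b. \<xi> (\<lambda>c. D b (c * a))))"
      by (simp add: sp.bidual_add[OF \<psi> bilinear_formD(1)[OF 1] bilinear_formD(1)[OF 2]]
          sp.bidual_add[OF \<phi> bilinear_contract[OF 1 \<psi>] bilinear_contract[OF 2 \<psi>]])
    also have "\<phi> (\<lambda>a. \<psi> (\<lambda>b. \<xi> (\<lambda>c. D b (c * a)))) = \<psi> (\<lambda>b. \<xi> (\<lambda>c. \<phi> (\<lambda>a. D b (c * a))))"
      using lim \<phi> \<psi> \<xi> by (simp add: limits_interchange_def)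
    finally show ?thesis
      using \<phi> \<psi> \<xi>
      by (simp add: second_adjoint_def restr_apply arens_apply arens_mem bilinear_formD(1)[OF bil])
  qed
  then show "second_adjoint D (arens \<phi> \<psi>) =
      right_act (bidual_algebra A) (second_adjoint D \<phi>) \<psi> +
      left_act (bidual_algebra A) \<phi> (second_adjoint D \<psi>)"
    by (auto simp: fun_eq_iff right_act_def left_act_def second_adjoint_def restr_def)
qed

lemma inner_derivation_if_limits_interchange:
  assumes D: "derivation A D" and lim: "limits_interchange D"
    and wa: "weakly_amenable (bidual_algebra A)"
  shows "inner_derivation A D"
proof -
  note bil = derivation_bilinear[OF D]
  have "inner_derivation (bidual_algebra A) (second_adjoint D)"
    using wa derivation_second_adjoint[OF D lim] by (simp add: weakly_amenable_def)
  then obtain F where F: "F \<in> carrier A'''"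
    and eq: "\<And>\<phi>. \<phi> \<in> carrier A'' \<Longrightarrow> second_adjoint D \<phi> =
        left_act (bidual_algebra A) \<phi> F - right_act (bidual_algebra A) F \<phi>"
    by (auto simp: inner_derivation_def dual_bidual_algebra)
  \<comment> \<open>The implementing functional is pulled back along the canonical
    embedding.\<close>
  define f where "f = (\<lambda>x. F (sp.evaluation x))"
  have "f \<in> carrier A'"
  proof (rule functionalI)
    fix x y c
    have "sp.evaluation (x + y) = sp.evaluation x + sp.evaluation y"
      by (auto simp: sp.evaluation_def restr_def fun_eq_iff functional_add)
    then show "f (x + y) = f x + f y"
      by (simp add: f_def dual_add[OF F evaluation_algebra_mem evaluation_algebra_mem])
    have "sp.evaluation (scl c x) = smul A'' c (sp.evaluation x)"
      by (auto simp: sp.evaluation_def restr_def fun_eq_iff functional_scl dual_sel(1))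
    then show "f (scl c x) = c * f x"
      by (simp add: f_def dual_smul[OF F evaluation_algebra_mem])
    have "nrm A'' (sp.evaluation x) \<le> norm x"
    proof (rule dl.nrm_dual_le)
      show "norm (sp.evaluation x g) \<le> norm x * nrm A' g" if "g \<in> carrier A'" for g
        using functional_le[OF that, of x] by (simp add: sp.evaluation_apply[OF that] mult.commute)
    qed simp
    then show "norm (f x) \<le> nrm A''' F * norm x"
      using bd.norm_le_nrm_dual[OF F evaluation_algebra_mem] bd.nrm_dual_nonneg[OF F] mult_left_mono
      unfolding f_def by (meson order_trans)
  qed
  moreover have "D a = left_act A a f - right_act A f a" for a
  proof
    fix c
    \<comment> \<open>On evaluations the second adjoint gives back \<open>D\<close>, and the Arens
      product gives back the product of the algebra.\<close>
    have "D a c = second_adjoint D (sp.evaluation a) (sp.evaluation c)"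
      by (simp add: second_adjoint_def restr_apply evaluation_algebra_mem sp.evaluation_apply
          bilinear_formD[OF bil] bilinear_contract[OF bil])
    also have "\<dots> = F (sp.evaluation (c * a)) - F (sp.evaluation (a * c))"
      by (simp add: eq evaluation_algebra_mem left_act_def right_act_def arens_evaluation)
    finally show "D a c = (left_act A a f - right_act A f a) c"
      by (simp add: left_act_def right_act_def f_def)
  qed
  ultimately show ?thesis unfolding inner_derivation_def by blast
qed

section \<open>Arens regularity of the adjoint of the product\<close>

abbreviation adjoint_regular where
  "adjoint_regular \<equiv> arens_regular A' A A' (arens_adjoint A (mul A))"

text \<open>The triple adjoint of the adjoint product, at \<open>F\<close> and \<psi> and applied to
  \<omega>, is F(\<psi>\<box>\<omega>); the flipped construction computes the right-hand side.
  Regularity thus represents \<psi> \<mapsto> F(\<psi>\<box>\<omega>) by an element of the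
  dual.\<close>

lemma adjoint_regular_arens:
  assumes reg: adjoint_regular
    and F: "F \<in> carrier A'''" and \<psi>: "\<psi> \<in> carrier A''" and \<omega>: "\<omega> \<in> carrier A''"
  shows "F (arens \<psi> \<omega>) = \<psi> (\<lambda>x. F (arens (sp.evaluation x) \<omega>))"
proof -
  have "restr A' (\<lambda>f. \<psi> (\<lambda>a. \<omega> (\<lambda>b. f (a * b)))) = arens \<psi> \<omega>" by (simp add: arens_def)
  moreover have "restr A' (\<lambda>f. \<omega> (\<lambda>b. f (x * b))) = arens (sp.evaluation x) \<omega>" for x
    using arens_evaluation_left[OF \<omega>] by (auto simp: restr_def fun_eq_iff arens_def)
  moreover have "triple_adjoint A' A A' (arens_adjoint A (mul A)) F \<psi> \<omega> =
      flip (triple_adjoint A A' A' (flip (arens_adjoint A (mul A)))) F \<psi> \<omega>"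
    using reg F \<psi> by (auto simp: arens_regular_def)
  ultimately show ?thesis
    using \<omega> by (simp add: triple_adjoint_def arens_adjoint_def flip_def restr_def)
qed

text \<open>Apply \<open>adjoint_regular_arens\<close> to the functional \<omega> \<mapsto> \<psi>_b
  \<omega>(u b) and to the product of \<xi> with the evaluation at \<open>x\<close>. The right
  factor \<open>x\<close> is what brings in an Arens product.\<close>

lemma adjoint_regular_swap:
  assumes reg: adjoint_regular and u: "bilinear_form u"
    and \<psi>: "\<psi> \<in> carrier A''" and \<xi>: "\<xi> \<in> carrier A''"
  shows "\<psi> (\<lambda>b. \<xi> (\<lambda>c. u b (c * x))) = \<xi> (\<lambda>c. \<psi> (\<lambda>b. u b (c * x)))"
  using adjoint_regular_arens[OF reg bidual_nested_mem[OF u \<psi>] \<xi> evaluation_algebra_mem[of x]]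
  by (simp add: restr_apply arens_mem \<xi> evaluation_algebra_mem arens_evaluation_right
      bilinear_formD[OF u] arens_evaluation sp.evaluation_apply)

text \<open>Regularity extends the vanishing from x\<omega> to all products \<psi>\<box>\<omega>,
  and weak amenability then forces \<Lambda> = 0. Identities between functionals on the bidual
  therefore need checking only at x\<omega>.\<close>

lemma functional_eq_0_if_vanishes_on_module_products:
  assumes reg: adjoint_regular and wa: "weakly_amenable (bidual_algebra A)"
    and L: "\<Lambda> \<in> carrier A'''"
    and van: "\<And>x \<omega>. \<omega> \<in> carrier A'' \<Longrightarrow> \<Lambda> (arens (sp.evaluation x) \<omega>) = 0"
    and \<phi>: "\<phi> \<in> carrier A''"
  shows "\<Lambda> \<phi> = 0"
proof (rule weakly_amenable_functional_eq_0[where \<Lambda>=\<Lambda> and \<phi>=\<phi>, OF _ _ wa])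
  show "normed_space_on (bidual_algebra A)"
    using dl.normed_space_on_dual unfolding normed_space_on_def bidual_sel .
  show "\<Lambda> \<in> carrier (dual (bidual_algebra A))" using L by (simp add: dual_bidual_algebra)
  fix \<psi> \<omega> assume "\<psi> \<in> carrier (bidual_algebra A)" "\<omega> \<in> carrier (bidual_algebra A)"
  then have w: "\<psi> \<in> carrier A''" "\<omega> \<in> carrier A''" by simp_all
  show "\<Lambda> (mul (bidual_algebra A) \<psi> \<omega>) = 0"
    by (simp add: adjoint_regular_arens[OF reg L w] van[OF w(2)] sp.bidual_zero[OF w(1)])
  show "mul (bidual_algebra A) \<psi> \<omega> \<in> carrier (bidual_algebra A)"
    by (simp add: arens_mem w)
qed (simp add: \<phi>)

text \<open>Both sides are functionals of \<psi>, with difference \<Lambda>. At x\<omega> the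
  argument becomes f(axb); reading it as f((ax)b) gives the variable \<open>a\<close> a right
  factor, so \<open>adjoint_regular_swap\<close> applies.\<close>

lemma arens_regular_if_adjoint_regular:
  assumes reg: adjoint_regular and wa: "weakly_amenable (bidual_algebra A)"
    and f: "f \<in> carrier A'" and \<phi>: "\<phi> \<in> carrier A''" and \<psi>: "\<psi> \<in> carrier A''"
  shows "\<psi> (\<lambda>b. \<phi> (\<lambda>a. f (a * b))) = \<phi> (\<lambda>a. \<psi> (\<lambda>b. f (a * b)))"
proof -
  note u = bilinear_mul[OF f]
  note u' = bilinear_flip[OF u]
  define h where "h = (\<lambda>b. \<phi> (\<lambda>a. f (a * b)))"
  have h: "h \<in> carrier A'" unfolding h_def by (rule bilinear_contract[OF u' \<phi>])
  define \<Lambda> where "\<Lambda> = (\<lambda>\<omega>. dl.evaluation h \<omega> - restr A'' (\<lambda>\<omega>. \<phi> (\<lambda>a. \<omega> (\<lambda>b. f (a * b)))) \<omega>)"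
  have L: "\<Lambda> \<in> carrier A'''"
    unfolding \<Lambda>_def by (rule bd.diff_mem_dual[OF dl.evaluation_mem[OF h] bidual_nested_mem[OF u \<phi>]])
  have "\<Lambda> (arens (sp.evaluation x) \<omega>) = 0" if \<omega>: "\<omega> \<in> carrier A''" for x \<omega>
  proof -
    have mem: "arens (sp.evaluation x) \<omega> \<in> carrier A''" by (rule arens_mem[OF evaluation_algebra_mem \<omega>])
    have "arens (sp.evaluation x) \<omega> (\<lambda>b. f (a * b)) = \<omega> (\<lambda>b. f (a * x * b))" for a
      using arens_evaluation_left[OF \<omega> functional_mul_left[OF f]] by (simp add: mult.assoc)
    moreover have "arens (sp.evaluation x) \<omega> h = \<omega> (\<lambda>b. \<phi> (\<lambda>a. f (a * x * b)))"
      using arens_evaluation_left[OF \<omega> h] by (simp add: h_def mult.assoc)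
    ultimately show ?thesis
      using adjoint_regular_swap[OF reg u' \<omega> \<phi>, of x]
      by (simp add: \<Lambda>_def dl.evaluation_apply mem restr_apply)
  qed
  from functional_eq_0_if_vanishes_on_module_products[OF reg wa L this \<psi>]
  show ?thesis by (simp add: \<Lambda>_def dl.evaluation_apply \<psi> restr_apply h_def)
qed

lemma limits_interchange_if_adjoint_regular:
  assumes reg: adjoint_regular and wa: "weakly_amenable (bidual_algebra A)"
    and D: "derivation A D"
  shows "limits_interchange D"
  unfolding limits_interchange_def
proof (intro ballI)
  fix \<phi> \<psi> \<xi> assume \<phi>: "\<phi> \<in> carrier A''" and \<psi>: "\<psi> \<in> carrier A''" and \<xi>: "\<xi> \<in> carrier A''"
  note bil = derivation_bilinear[OF D]
  note swap = adjoint_regular_swap[OF reg]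
  have bca: "trilinear_form (\<lambda>b c a. D b (c * a))" by (rule trilinear_mul[OF bil])
  have acb: "trilinear_form (\<lambda>a c b. D b (c * a))" by (rule trilinear_flip_outer[OF bca])
  have abc: "trilinear_form (\<lambda>a b c. D b (c * a))" by (rule trilinear_flip_inner[OF acb])
  define h where "h = (\<lambda>a. \<psi> (\<lambda>b. \<xi> (\<lambda>c. D b (c * a))))"
  have h: "h \<in> carrier A'"
    unfolding h_def by (rule bilinear_contract[OF trilinear_contract[OF abc \<xi>] \<psi>])
  \<comment> \<open>By the Leibniz rule (D b)(ea) = D(be)(a) - (D e)(ab). In the first term
    \<open>b\<close> has the right factor \<open>e\<close>, so \<open>swap\<close> applies; the
    second is covered by Arens regularity of the algebra.\<close>
  have key: "\<psi> (\<lambda>b. \<omega> (\<lambda>a. D b (e * a))) = \<omega> (\<lambda>a. \<psi> (\<lambda>b. D b (e * a)))"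
    if \<omega>: "\<omega> \<in> carrier A''" for \<omega> e
  proof -
    have be: "bilinear_form (\<lambda>b a. D (b * e) a)"
      by (rule bilinear_flip[OF bilinear_mul_right[OF bilinear_flip[OF bil]]])
    have ab: "bilinear_form (\<lambda>a b. D e (a * b))"
      by (rule bilinear_mul[OF bilinear_formD(1)[OF bil]])
    note ba = bilinear_flip[OF ab] and eb = bilinear_flip[OF be]
    have eq: "D b (e * a) = D (b * e) a - D e (a * b)" for a b
      using derivation_mul[OF D, of b e a] by simp
    have "\<psi> (\<lambda>b. \<omega> (\<lambda>a. D b (e * a))) = \<psi> (\<lambda>b. \<omega> (D (b * e))) - \<psi> (\<lambda>b. \<omega> (\<lambda>a. D e (a * b)))"
      by (simp add: eq sp.bidual_diff[OF \<omega> bilinear_formD(1)[OF be] bilinear_formD(1)[OF ba]]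
          sp.bidual_diff[OF \<psi> bilinear_contract[OF be \<omega>] bilinear_contract[OF ba \<omega>]])
    also have "\<psi> (\<lambda>b. \<omega> (D (b * e))) = \<omega> (\<lambda>a. \<psi> (\<lambda>b. D (b * e) a))"
      using swap[OF bilinear_flip[OF bil] \<omega> \<psi>, of e] by simp
    also have "\<psi> (\<lambda>b. \<omega> (\<lambda>a. D e (a * b))) = \<omega> (\<lambda>a. \<psi> (\<lambda>b. D e (a * b)))"
      by (rule arens_regular_if_adjoint_regular[OF reg wa bilinear_formD(1)[OF bil] \<omega> \<psi>])
    also have "\<omega> (\<lambda>a. \<psi> (\<lambda>b. D (b * e) a)) - \<omega> (\<lambda>a. \<psi> (\<lambda>b. D e (a * b))) =
        \<omega> (\<lambda>a. \<psi> (\<lambda>b. D b (e * a)))"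
      by (simp add: eq sp.bidual_diff[OF \<psi> bilinear_formD(1)[OF eb] bilinear_formD(1)[OF ab]]
          sp.bidual_diff[OF \<omega> bilinear_contract[OF eb \<psi>] bilinear_contract[OF ab \<psi>]])
    finally show ?thesis .
  qed
  \<comment> \<open>The difference of the two sides of the interchange, as a functional of
    \<phi>.\<close>
  define \<Lambda> where "\<Lambda> = (\<lambda>\<omega>. dl.evaluation h \<omega> -
    restr A'' (\<lambda>\<omega>. \<psi> (\<lambda>b. \<xi> (\<lambda>c. \<omega> (\<lambda>a. D b (c * a))))) \<omega>)"
  have L: "\<Lambda> \<in> carrier A'''"
    unfolding \<Lambda>_def by (rule bd.diff_mem_dual[OF dl.evaluation_mem[OF h] bidual_nested2_mem[OF bca \<psi> \<xi>]])
  have "\<Lambda> (arens (sp.evaluation x) \<omega>) = 0" if \<omega>: "\<omega> \<in> carrier A''" for x \<omega>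
  proof -
    \<comment> \<open>With the factor \<open>x\<close> beside \<open>c\<close>, \<psi> and \<xi> are
      exchanged, \<omega> is moved inwards past \<xi> and then, by \<open>key\<close>, past \<psi>,
      and finally \<psi> and \<xi> return to their original order.\<close>
    have "\<omega> (\<lambda>a. \<psi> (\<lambda>b. \<xi> (\<lambda>c. D b (c * (x * a))))) = \<omega> (\<lambda>a. \<xi> (\<lambda>c. \<psi> (\<lambda>b. D b (c * x * a))))"
      using swap[OF bilinear_mul_right[OF bil] \<psi> \<xi>, of x] by (simp add: mult.assoc)
    also have "\<dots> = \<xi> (\<lambda>c. \<omega> (\<lambda>a. \<psi> (\<lambda>b. D b (c * x * a))))"
      by (rule swap[OF trilinear_contract[OF acb \<psi>] \<omega> \<xi>])
    also have "\<dots> = \<xi> (\<lambda>c. \<psi> (\<lambda>b. \<omega> (\<lambda>a. D b (c * x * a))))"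
      by (simp only: key[OF \<omega>])
    also have "\<dots> = \<psi> (\<lambda>b. \<xi> (\<lambda>c. \<omega> (\<lambda>a. D b (c * x * a))))"
      by (rule swap[OF trilinear_contract[OF bca \<omega>] \<psi> \<xi>, symmetric])
    finally have swapped: "\<omega> (\<lambda>a. h (x * a)) = \<psi> (\<lambda>b. \<xi> (\<lambda>c. \<omega> (\<lambda>a. D b (c * x * a))))"
      unfolding h_def .
    have mem: "arens (sp.evaluation x) \<omega> \<in> carrier A''" by (rule arens_mem[OF evaluation_algebra_mem \<omega>])
    have "arens (sp.evaluation x) \<omega> (\<lambda>a. D b (c * a)) = \<omega> (\<lambda>a. D b (c * x * a))" for b c
      using arens_evaluation_left[OF \<omega> functional_mul_left[OF bilinear_formD(1)[OF bil]]]
      by (simp add: mult.assoc)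
    then show ?thesis
      by (simp add: \<Lambda>_def dl.evaluation_apply mem restr_apply swapped
          arens_evaluation_left[OF \<omega> h])
  qed
  from functional_eq_0_if_vanishes_on_module_products[OF reg wa L this \<phi>]
  show "\<phi> (\<lambda>a. \<psi> (\<lambda>b. \<xi> (\<lambda>c. D b (c * a)))) = \<psi> (\<lambda>b. \<xi> (\<lambda>c. \<phi> (\<lambda>a. D b (c * a))))"
    by (simp add: \<Lambda>_def dl.evaluation_apply \<phi> restr_apply h_def)
qed

section \<open>Weakly compact derivations\<close>

text \<open>Adjacent limits need not commute in general, but \<open>swap\<close> may be applied to
  Arens products in either slot. Hence \<xi> is first pulled in front of \<psi>, the Leibniz rule
  splits the form into two terms for which \<phi> and \<xi> can be exchanged, and the terms are
  reassembled.\<close>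

lemma limits_interchange_if_swap:
  assumes D: "derivation A D"
    and swap: "\<And>\<phi> \<xi>. \<phi> \<in> carrier A'' \<Longrightarrow> \<xi> \<in> carrier A'' \<Longrightarrow>
      \<phi> (\<lambda>a. \<xi> (D a)) = \<xi> (\<lambda>c. \<phi> (\<lambda>a. D a c))"
  shows "limits_interchange D"
  unfolding limits_interchange_def
proof (intro ballI)
  fix \<phi> \<psi> \<xi> assume \<phi>: "\<phi> \<in> carrier A''" and \<psi>: "\<psi> \<in> carrier A''" and \<xi>: "\<xi> \<in> carrier A''"
  note bil = derivation_bilinear[OF D]
  note D' = bilinear_formD(1)[OF bil] and ev = evaluation_algebra_mem
  have contr: "(\<lambda>c. \<omega> (\<lambda>b. D b c)) \<in> carrier A'" if "\<omega> \<in> carrier A''" for \<omega>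
    by (rule bilinear_contract[OF bilinear_flip[OF bil] that])
  have cab1: "trilinear_form (\<lambda>c a b. D (a * b) c)"
    by (rule trilinear_mul[OF bilinear_flip[OF bil]])
  have abc2: "trilinear_form (\<lambda>a b c. D a (b * c))" by (rule trilinear_mul[OF bil])
  have acb2: "trilinear_form (\<lambda>a c b. D a (b * c))" by (rule trilinear_flip_inner[OF abc2])
  have acb1: "trilinear_form (\<lambda>a c b. D (a * b) c)"
    by (rule trilinear_flip_inner[OF trilinear_flip_outer[OF trilinear_flip_inner[OF cab1]]])
  have cab2: "trilinear_form (\<lambda>c a b. D a (b * c))"
    by (rule trilinear_flip_inner[OF trilinear_flip_outer[OF abc2]])
  have split: "\<psi> (\<lambda>b. D b (c * a)) = \<psi> (\<lambda>b. D (a * b) c) - \<psi> (\<lambda>b. D a (b * c))" for a c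
  proof -
    have "D b (c * a) = D (a * b) c - D a (b * c)" for b
      using derivation_mul[OF D, of a b c] by simp
    then have "\<psi> (\<lambda>b. D b (c * a)) = \<psi> (\<lambda>b. D (a * b) c - D a (b * c))" by presburger
    also have "\<dots> = \<psi> (\<lambda>b. D (a * b) c) - \<psi> (\<lambda>b. D a (b * c))"
      by (rule sp.bidual_diff[OF \<psi> functional_mul_left[OF bilinear_formD(2)[OF bil]]
            functional_mul_right[OF D']])
    finally show ?thesis .
  qed
  \<comment> \<open>Both sides equal \<phi>_a \<psi>_b \<xi>(D(ab)): one by \<open>swap\<close> for
    the product of the evaluation at \<open>a\<close> with \<psi>, the other by \<open>swap\<close>
    for \<phi>\<box>\<psi>.\<close>
  have lim1: "\<phi> (\<lambda>a. \<xi> (\<lambda>c. \<psi> (\<lambda>b. D (a * b) c))) = \<xi> (\<lambda>c. \<phi> (\<lambda>a. \<psi> (\<lambda>b. D (a * b) c)))"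
  proof -
    have "\<xi> (\<lambda>c. \<psi> (\<lambda>b. D (a * b) c)) = \<psi> (\<lambda>b. \<xi> (D (a * b)))" for a
      using swap[OF arens_mem[OF ev \<psi>] \<xi>, of a]
      by (simp add: arens_evaluation_left \<psi> bilinear_contract[OF bil \<xi>] bilinear_formD(2)[OF bil])
    then show ?thesis
      using swap[OF arens_mem[OF \<phi> \<psi>] \<xi>]
      by (simp add: arens_apply bilinear_contract[OF bil \<xi>] bilinear_formD(2)[OF bil])
  qed
  have lim2: "\<phi> (\<lambda>a. \<xi> (\<lambda>c. \<psi> (\<lambda>b. D a (b * c)))) = \<xi> (\<lambda>c. \<phi> (\<lambda>a. \<psi> (\<lambda>b. D a (b * c))))"
  proof -
    \<comment> \<open>This is the second Arens product of \<psi> and \<xi>: the limit over the right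
      factor is taken last.\<close>
    define \<eta> where "\<eta> = restr A' (\<lambda>f. \<xi> (\<lambda>c. \<psi> (\<lambda>b. f (b * c))))"
    have \<eta>: "\<eta> \<in> carrier A''"
      unfolding \<eta>_def
    proof (rule iterated_bidual_mem[OF _ _ \<xi> \<psi>])
      fix f assume f: "f \<in> carrier A'"
      show "bilinear_form (\<lambda>c b. f (b * c))" by (rule bilinear_flip[OF bilinear_mul[OF f]])
      show "norm (f (b * c)) \<le> nrm A' f * norm c * norm b" for b c
        using norm_functional_mul_le[OF f, of b c] by (simp add: mult_ac)
    qed
    have "\<psi> (\<lambda>b. \<phi> (\<lambda>a. D a (b * c))) = \<phi> (\<lambda>a. \<psi> (\<lambda>b. D a (b * c)))" for c
      using swap[OF \<phi> arens_mem[OF \<psi> ev], of c]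
      by (simp add: arens_evaluation_right D' contr[OF \<phi>])
    then show ?thesis
      using swap[OF \<phi> \<eta>] by (simp add: \<eta>_def restr_apply D' contr[OF \<phi>])
  qed
  have "\<psi> (\<lambda>b. \<xi> (\<lambda>c. D b (c * a))) = \<xi> (\<lambda>c. \<psi> (\<lambda>b. D b (c * a)))" for a
    using swap[OF \<psi> arens_mem[OF \<xi> ev], of a]
    by (simp add: arens_evaluation_right D' contr[OF \<psi>])
  then have "\<phi> (\<lambda>a. \<psi> (\<lambda>b. \<xi> (\<lambda>c. D b (c * a)))) = \<phi> (\<lambda>a. \<xi> (\<lambda>c. \<psi> (\<lambda>b. D b (c * a))))"
    by simp
  also have "\<dots> = \<phi> (\<lambda>a. \<xi> (\<lambda>c. \<psi> (\<lambda>b. D (a * b) c))) - \<phi> (\<lambda>a. \<xi> (\<lambda>c. \<psi> (\<lambda>b. D a (b * c))))"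
    by (simp add: split
        sp.bidual_diff[OF \<xi> bilinear_formD(1)[OF trilinear_contract[OF acb1 \<psi>]]
          bilinear_formD(1)[OF trilinear_contract[OF acb2 \<psi>]]]
        sp.bidual_diff[OF \<phi> bilinear_contract[OF trilinear_contract[OF acb1 \<psi>] \<xi>]
          bilinear_contract[OF trilinear_contract[OF acb2 \<psi>] \<xi>]])
  also have "\<dots> = \<xi> (\<lambda>c. \<phi> (\<lambda>a. \<psi> (\<lambda>b. D b (c * a))))"
    by (simp add: lim1 lim2 split
        sp.bidual_diff[OF \<phi> bilinear_formD(1)[OF trilinear_contract[OF cab1 \<psi>]]
          bilinear_formD(1)[OF trilinear_contract[OF cab2 \<psi>]]]
        sp.bidual_diff[OF \<xi> bilinear_contract[OF trilinear_contract[OF cab1 \<psi>] \<phi>]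
          bilinear_contract[OF trilinear_contract[OF cab2 \<psi>] \<phi>]])
  \<comment> \<open>Here \<open>swap\<close> for \<psi> and \<xi>\<box>\<phi> moves \<psi> outwards
    across two limits at once.\<close>
  also have "\<dots> = \<psi> (\<lambda>b. \<xi> (\<lambda>c. \<phi> (\<lambda>a. D b (c * a))))"
    using swap[OF \<psi> arens_mem[OF \<xi> \<phi>]] by (simp add: arens_apply D' contr[OF \<psi>])
  finally show "\<phi> (\<lambda>a. \<psi> (\<lambda>b. \<xi> (\<lambda>c. D b (c * a)))) = \<psi> (\<lambda>b. \<xi> (\<lambda>c. \<phi> (\<lambda>a. D b (c * a))))" .
qed

text \<open>A near-minimiser of the squared distance satisfies an approximate variational inequality;
  it bounds the norm of a functional that would separate \<open>\<phi>\<close> from the ball.\<close>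

lemma helly_approximation:
  assumes \<phi>: "\<phi> \<in> carrier A''" and "finite I" and f: "\<And>i. i \<in> I \<Longrightarrow> f i \<in> carrier A'" and e: "0 < e"
  obtains a where "norm a \<le> nrm A'' \<phi>" "(\<Sum>i\<in>I. (norm (f i a - \<phi> (f i)))\<^sup>2) \<le> e"
proof -
  define R where "R = nrm A'' \<phi>"
  have R: "0 \<le> R" unfolding R_def by (rule dl.nrm_dual_nonneg[OF \<phi>])
  define q where "q = (\<lambda>a. \<Sum>i\<in>I. (norm (f i a - \<phi> (f i)))\<^sup>2)"
  \<comment> \<open>For \<open>a\<close> and \<open>b\<close> in the ball of radius
    \<open>R\<close>, b - a has norm at most 2R, so \<open>M\<close> bounds the second-order term of
    \<open>q\<close> along the segment from \<open>a\<close> to \<open>b\<close>.\<close>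
  define M where "M = (\<Sum>i\<in>I. (nrm A' (f i) * (2 * R))\<^sup>2)"
  have M: "0 \<le> M" unfolding M_def by (rule sum_nonneg) simp
  \<comment> \<open>The step length along a segment. Excess t^2 over the infimum and the
    second-order term t^2 M leave an error t (1 + M) after division by \<open>t\<close>, and this is
    at most \<open>e\<close>.\<close>
  define t where "t = min 1 (e / (1 + M))"
  have t: "0 < t" "t \<le> 1" using e M by (auto simp: t_def)
  have "t * (1 + M) \<le> e"
    using M min.cobounded2[of 1 "e / (1 + M)"] by (simp add: t_def flip: pos_le_divide_eq)
  define m where "m = (INF a\<in>cball 0 R. q a)"
  have bdd: "bdd_below (q ` cball 0 R)"
    by (rule bdd_belowI2[where m=0]) (simp add: q_def sum_nonneg)
  have "m < m + t\<^sup>2" using t by simp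
  then obtain a where a: "norm a \<le> R" "q a < m + t\<^sup>2"
    unfolding m_def using R by (subst (asm) cINF_less_iff[OF _ bdd]) auto
  define r where "r = (\<lambda>i. f i a - \<phi> (f i))"
  have lin: "f i (x + y) = f i x + f i y" "f i (x - y) = f i x - f i y" "f i (s *\<^sub>R x) = s *\<^sub>R f i x"
    if "i \<in> I" for i x y s
  proof -
    show add: "f i (x + y) = f i x + f i y" for x y by (rule functional_add[OF f[OF that]])
    show "f i (x - y) = f i x - f i y" using add[of "x - y" y] by (simp add: algebra_simps)
    show "f i (s *\<^sub>R x) = s *\<^sub>R f i x"
      using functional_scl[OF f[OF that], of "of_real s" x] by (simp add: of_real_scl scaleR_conv_of_real)
  qed
  have square: "(norm (x + t *\<^sub>R y))\<^sup>2 = (norm x)\<^sup>2 + 2 * t * (x \<bullet> y) + t\<^sup>2 * (norm y)\<^sup>2" for x y :: 'k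
    unfolding power2_norm_eq_inner
    by (simp add: inner_add_left inner_add_right inner_commute[of y x] power2_eq_square algebra_simps)
  have variational: "- (\<Sum>i\<in>I. r i \<bullet> f i b) \<le> e - (\<Sum>i\<in>I. r i \<bullet> f i a)" if b: "norm b \<le> R" for b
  proof -
    have ab: "norm (b - a) \<le> 2 * R" using norm_triangle_ineq4[of b a] a(1) b by linarith
    have "norm (a + t *\<^sub>R (b - a)) \<le> R"
    proof -
      have "a + t *\<^sub>R (b - a) = (1 - t) *\<^sub>R a + t *\<^sub>R b" by (simp add: algebra_simps)
      then have "norm (a + t *\<^sub>R (b - a)) \<le> (1 - t) * norm a + t * norm b"
        using norm_triangle_ineq[of "(1 - t) *\<^sub>R a" "t *\<^sub>R b"] t by simp
      also have "\<dots> \<le> (1 - t) * R + t * R"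
        using t a(1) b by (intro add_mono mult_left_mono) auto
      finally show ?thesis by (simp add: algebra_simps)
    qed
    then have "m \<le> q (a + t *\<^sub>R (b - a))"
      unfolding m_def by (intro cINF_lower[OF bdd]) simp
    also have "\<dots> = (\<Sum>i\<in>I. (norm (r i))\<^sup>2 + 2 * t * (r i \<bullet> f i (b - a)) + t\<^sup>2 * (norm (f i (b - a)))\<^sup>2)"
      unfolding q_def
    proof (rule sum.cong)
      fix i assume i: "i \<in> I"
      have "f i (a + t *\<^sub>R (b - a)) - \<phi> (f i) = r i + t *\<^sub>R f i (b - a)"
        by (simp add: lin[OF i] r_def)
      then show "(norm (f i (a + t *\<^sub>R (b - a)) - \<phi> (f i)))\<^sup>2 =
          (norm (r i))\<^sup>2 + 2 * t * (r i \<bullet> f i (b - a)) + t\<^sup>2 * (norm (f i (b - a)))\<^sup>2"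
        by (simp add: square)
    qed simp
    also have "\<dots> \<le> (\<Sum>i\<in>I. (norm (r i))\<^sup>2 + 2 * t * (r i \<bullet> f i (b - a)) + t\<^sup>2 * (nrm A' (f i) * (2 * R))\<^sup>2)"
    proof (rule sum_mono)
      fix i assume i: "i \<in> I"
      have "norm (f i (b - a)) \<le> nrm A' (f i) * (2 * R)"
        using functional_le[OF f[OF i], of "b - a"] mult_left_mono[OF ab sp.nrm_dual_nonneg[OF f[OF i]]]
        by linarith
      then show "(norm (r i))\<^sup>2 + 2 * t * (r i \<bullet> f i (b - a)) + t\<^sup>2 * (norm (f i (b - a)))\<^sup>2 \<le>
          (norm (r i))\<^sup>2 + 2 * t * (r i \<bullet> f i (b - a)) + t\<^sup>2 * (nrm A' (f i) * (2 * R))\<^sup>2"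
        by (intro add_left_mono mult_left_mono power_mono) auto
    qed
    also have "\<dots> = q a + 2 * t * (\<Sum>i\<in>I. r i \<bullet> f i (b - a)) + t\<^sup>2 * M"
      by (simp add: sum.distrib sum_distrib_left q_def r_def M_def)
    finally have "0 \<le> t\<^sup>2 + 2 * t * (\<Sum>i\<in>I. r i \<bullet> f i (b - a)) + t\<^sup>2 * M" using a(2) by linarith
    then have "0 \<le> t * (t * (1 + M) + 2 * (\<Sum>i\<in>I. r i \<bullet> f i (b - a)))"
      by (simp add: power2_eq_square algebra_simps)
    then have "0 \<le> t * (1 + M) + 2 * (\<Sum>i\<in>I. r i \<bullet> f i (b - a))"
      using t(1) by (simp add: zero_le_mult_iff)
    then have "- (\<Sum>i\<in>I. r i \<bullet> f i (b - a)) \<le> e" using \<open>t * (1 + M) \<le> e\<close> e by linarith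
    moreover have "(\<Sum>i\<in>I. r i \<bullet> f i (b - a)) = (\<Sum>i\<in>I. r i \<bullet> f i b) - (\<Sum>i\<in>I. r i \<bullet> f i a)"
      by (simp add: lin inner_diff_right sum_subtractf)
    ultimately show ?thesis by linarith
  qed
  \<comment> \<open>The variational inequality concerns a real-linear functional; the weights
    \<open>w i\<close> exhibit it as h \<bullet> 1 for a functional \<open>h\<close> that is linear
    over the scalar field.\<close>
  have "\<forall>i. \<exists>w. \<forall>z. (w * z) \<bullet> 1 = - r i \<bullet> z" by (metis inner_one_represents)
  then obtain w where w: "\<And>i z. (w i * z) \<bullet> 1 = - (r i \<bullet> z)" by (metis inner_minus_left)
  define h where "h = (\<lambda>x. \<Sum>i\<in>I. w i * f i x)"
  have h: "h \<in> carrier A'"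
    unfolding h_def by (intro sp.sum_mem_dual sp.scale_mem_dual f)
  have h_inner: "h x \<bullet> 1 = - (\<Sum>i\<in>I. r i \<bullet> f i x)" for x
    by (simp add: h_def inner_sum_left w sum_negf)
  define s where "s = e - (\<Sum>i\<in>I. r i \<bullet> f i a)"
  have norm_h: "norm (h b) \<le> s" if b: "norm b \<le> R" for b
  proof (cases "h b = 0")
    case True
    then show ?thesis using variational[OF b] h_inner[of b] by (simp add: s_def)
  next
    case False
    \<comment> \<open>The inequality controls only h \<bullet> 1; rotating \<open>b\<close> by this
      scalar of norm 1 makes the value of \<open>h\<close> equal to its norm.\<close>
    define u where "u = of_real (norm (h b)) / h b"
    have "norm (scl u b) \<le> R" using b False by (simp add: norm_scl u_def norm_divide)
    then have "h (scl u b) \<bullet> 1 \<le> s"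
      using variational[of "scl u b"] h_inner[of "scl u b"] by (simp add: s_def)
    moreover have "h (scl u b) = of_real (norm (h b))"
      using False by (simp add: functional_scl[OF h] u_def)
    moreover have "of_real x \<bullet> (1::'k) = x" for x
      by (simp add: of_real_def flip: power2_norm_eq_inner)
    ultimately show ?thesis by simp
  qed
  have s: "0 \<le> s" using order_trans[OF norm_ge_zero norm_h[of 0]] R by simp
  have "R * nrm A' h \<le> s"
  proof (cases "R = 0")
    case False
    then have R': "R > 0" using R by simp
    have "nrm A' h \<le> s / R"
    proof (rule sp.nrm_dual_le)
      fix x assume "x \<in> carrier A"
      show "norm (h x) \<le> s / R * nrm A x"
      proof (cases "x = 0")
        case True
        then show ?thesis using functional_scl[OF h, of 0 0] by simp
      next
        case False
        define k where "k = R / norm x"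
        have k: "k > 0" using False R' by (simp add: k_def)
        have "norm (h (scl (of_real k) x)) \<le> s"
          using False R' by (intro norm_h) (simp add: norm_scl k_def norm_divide)
        then have "k * norm (h x) \<le> s" using k by (simp add: functional_scl[OF h] norm_mult)
        then show ?thesis using False R' by (simp add: k_def field_simps)
      qed
    qed (use s R in simp)
    then show ?thesis using R' by (simp add: field_simps)
  qed (simp add: s)
  \<comment> \<open>\<open>R\<close> is the norm of \<phi>, so the bound on \<open>h\<close> on the
    ball passes to \<phi>(h). Since \<phi>(h) \<bullet> 1 is the negated sum of r_i \<bullet>
    \<phi>(f_i), the estimate by \<open>s\<close> rearranges to q(a) \<le> e.\<close>
  then have "norm (\<phi> h) \<le> s"
    using dl.norm_le_nrm_dual[OF \<phi> h] by (simp add: R_def)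
  moreover have "\<phi> h \<bullet> 1 \<le> norm (\<phi> h)" using norm_cauchy_schwarz[of "\<phi> h" 1] by simp
  moreover have "\<phi> h = (\<Sum>i\<in>I. w i * \<phi> (f i))"
    unfolding h_def
    by (simp add: sp.bidual_sum[OF \<phi>] sp.scale_mem_dual f sp.bidual_scale[OF \<phi>])
  then have "\<phi> h \<bullet> 1 = - (\<Sum>i\<in>I. r i \<bullet> \<phi> (f i))"
    by (simp add: inner_sum_left w sum_negf)
  ultimately have "(\<Sum>i\<in>I. r i \<bullet> f i a) - (\<Sum>i\<in>I. r i \<bullet> \<phi> (f i)) \<le> e"
    by (simp add: s_def)
  moreover have "(\<Sum>i\<in>I. r i \<bullet> f i a) - (\<Sum>i\<in>I. r i \<bullet> \<phi> (f i)) = q a"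
    by (simp add: q_def r_def power2_norm_eq_inner inner_diff_right sum_subtractf)
  ultimately show thesis using that[of a] a(1) by (simp add: q_def R_def)
qed

lemma topspace_weak_topology: "topspace (weak_topology A') = carrier A'"
proof -
  have "carrier A' = {x \<in> carrier A'. (\<lambda>_. 0) x \<in> (UNIV :: 'k set)}" by simp
  then have "carrier A' \<in> {{x \<in> carrier A'. \<phi> x \<in> U} | \<phi> U. \<phi> \<in> carrier A'' \<and> open U}"
    using dl.zero_mem_dual open_UNIV by blast
  then show ?thesis
    unfolding weak_topology_def topology_generated_by_topspace by blast
qed

text \<open>Helly's theorem provides the finite intersection property, and compactness then yields
  \<open>g\<close> in the dual with R \<omega>(g) = \<phi>_a \<omega>(T a) for every \<omega>. So
  the second adjoint of \<open>T\<close> sends \<phi> into the canonical image of the dual, and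
  evaluations identify R g with c \<mapsto> \<phi>_a (T a)(c).\<close>

lemma weakly_compact_swap:
  assumes T: "bilinear_form T" and comp: "weakly_compact A A' T"
    and \<phi>: "\<phi> \<in> carrier A''" and \<xi>: "\<xi> \<in> carrier A''"
  shows "\<phi> (\<lambda>a. \<xi> (T a)) = \<xi> (\<lambda>c. \<phi> (\<lambda>a. T a c))"
proof -
  define R where "R = nrm A'' \<phi>"
  have R: "0 \<le> R" unfolding R_def by (rule dl.nrm_dual_nonneg[OF \<phi>])
  define W where "W = weak_topology A'"
  define S where "S = W closure_of (T ` unit_ball A)"
  have topW: "topspace W = carrier A'" by (simp add: W_def topspace_weak_topology)
  have TS: "T ` unit_ball A \<subseteq> S"
    unfolding S_def using topW bilinear_formD(1)[OF T] by (intro closure_of_subset) auto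
  have S: "compactin W S" using comp by (simp add: weakly_compact_def S_def W_def)
  \<comment> \<open>The conditions on \<open>g\<close>, relaxed by \<open>e\<close>. The factor
    \<open>R\<close> stands with \<omega>(h), as compactness concerns the image of the unit ball;
    this form also makes sense for R = 0.\<close>
  define C where "C = (\<lambda>(\<omega>, e). {h \<in> carrier A'. norm (of_real R * \<omega> h - \<phi> (\<lambda>a. \<omega> (T a))) \<le> e})"
  define P where "P = carrier A'' \<times> {0::real<..}"
  have closed: "closedin W (C p)" if p: "p \<in> P" for p
  proof -
    obtain \<omega> e where p_eq: "p = (\<omega>, e)" by (cases p)
    have \<omega>: "\<omega> \<in> carrier A''" using p by (simp add: P_def p_eq)
    define U where "U = {z::'k. e < norm (of_real R * z - \<phi> (\<lambda>a. \<omega> (T a)))}"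
    have "open U" unfolding U_def by (intro open_Collect_less continuous_intros)
    then have "openin W {x \<in> carrier A'. \<omega> x \<in> U}"
      unfolding W_def weak_topology_def using \<omega> by (intro topology_generated_by_Basis) blast
    moreover have "carrier A' - C p = {x \<in> carrier A'. \<omega> x \<in> U}"
      by (auto simp: C_def p_eq U_def)
    moreover have "C p \<subseteq> carrier A'" by (auto simp: C_def p_eq)
    ultimately show ?thesis by (simp add: closedin_def topW)
  qed
  have fip: "S \<inter> \<Inter>\<F> \<noteq> {}" if "finite \<F>" "\<F> \<subseteq> C ` P" for \<F>
  proof -
    have "\<exists>I\<subseteq>P. finite I \<and> \<F> = C ` I" by (rule finite_subset_image[OF that])
    then obtain I where I: "finite I" "I \<subseteq> P" "\<F> = C ` I" by blast
    \<comment> \<open>One tolerance for all conditions in \<open>I\<close>; the inserted 1 covers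
      the case of an empty \<open>I\<close>.\<close>
    define d where "d = Min (insert 1 (snd ` I))"
    have d: "0 < d" "\<And>p. p \<in> I \<Longrightarrow> d \<le> snd p"
      using I by (auto simp: d_def P_def)
    define f where "f = (\<lambda>(p :: (('a \<Rightarrow> 'k) \<Rightarrow> 'k) \<times> real) a. fst p (T a))"
    have f: "f p \<in> carrier A'" if "p \<in> I" for p
      unfolding f_def using that I(2) by (intro bilinear_contract[OF T]) (auto simp: P_def)
    obtain a where a: "norm a \<le> R" "(\<Sum>p\<in>I. (norm (f p a - \<phi> (f p)))\<^sup>2) \<le> d\<^sup>2"
      using helly_approximation[where f=f and e="d\<^sup>2", OF \<phi> I(1) f] d(1) unfolding R_def by auto
    \<comment> \<open>For R = 0 the inverse is 0, so u = 0; the norm bound gives a = 0 as well, and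
      \<open>a\<close> is still R times \<open>u\<close>.\<close>
    define u where "u = scl (of_real (inverse R)) a"
    have u: "u \<in> unit_ball A"
      using a(1) R by (cases "R = 0") (auto simp: u_def unit_ball_def norm_scl norm_divide field_simps)
    have Ru: "scl (of_real R) u = a"
      using a(1) by (cases "R = 0") (auto simp: u_def)
    have "T u \<in> C p" if p: "p \<in> I" for p
    proof -
      have "(norm (f p a - \<phi> (f p)))\<^sup>2 \<le> d\<^sup>2"
        using member_le_sum[OF p, of "\<lambda>p. (norm (f p a - \<phi> (f p)))\<^sup>2"] I(1) a(2) by simp
      then have "norm (f p a - \<phi> (f p)) \<le> d" using d(1) by (simp add: power2_le_iff_abs_le)
      moreover have "f p a = of_real R * f p u"
        using functional_scl[OF f[OF p], of "of_real R" u] by (simp add: Ru)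
      ultimately show ?thesis
        using d(2)[OF p] bilinear_formD(1)[OF T] by (auto simp: C_def f_def split: prod.split)
    qed
    then show ?thesis using TS u I(3) by blast
  qed
  have "S \<inter> \<Inter>(C ` P) \<noteq> {}"
    using S fip closed unfolding compactin_fip by blast
  then obtain g where g: "g \<in> S" "\<And>p. p \<in> P \<Longrightarrow> g \<in> C p" by blast
  have g_mem: "g \<in> carrier A'" using g(1) closure_of_subset_topspace[of W] by (auto simp: S_def topW)
  have g_eq: "of_real R * \<omega> g = \<phi> (\<lambda>a. \<omega> (T a))" if "\<omega> \<in> carrier A''" for \<omega>
  proof -
    have "norm (of_real R * \<omega> g - \<phi> (\<lambda>a. \<omega> (T a))) \<le> 0"
    proof (rule field_le_epsilon)
      fix e :: real assume "0 < e"
      then show "norm (of_real R * \<omega> g - \<phi> (\<lambda>a. \<omega> (T a))) \<le> 0 + e"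
        using g(2)[of "(\<omega>, e)"] that by (simp add: P_def C_def)
    qed
    then show ?thesis by simp
  qed
  have "(\<lambda>c. \<phi> (\<lambda>a. T a c)) = (\<lambda>c. of_real R * g c)"
    using g_eq[OF evaluation_algebra_mem]
    by (simp add: sp.evaluation_apply g_mem bilinear_formD(1)[OF T])
  then have "\<xi> (\<lambda>c. \<phi> (\<lambda>a. T a c)) = of_real R * \<xi> g"
    by (simp add: sp.bidual_scale[OF \<xi> g_mem])
  then show ?thesis using g_eq[OF \<xi>] by simp
qed

end

theorem corollary3:
  fixes scl :: "'k::{real_normed_field, euclidean_space} \<Rightarrow> 'a::{real_normed_algebra, banach} \<Rightarrow> 'a"
    and A :: "('k, 'a) nalgebra"
  assumes "banach_algebra scl"
    and "A = algebra_of scl"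
    and "arens_regular (dual A) A (dual A) (arens_adjoint A (mul A)) \<or>
         (\<forall>D. derivation A D \<longrightarrow> weakly_compact A (dual A) D)"
    and "weakly_amenable (bidual_algebra A)"
  shows "weakly_amenable A"
  unfolding weakly_amenable_def
proof (intro allI impI)
  interpret banach_algebra scl by (rule assms(1))
  fix D assume "derivation A D"
  then have D: "derivation (algebra_of scl) D" by (simp add: assms(2))
  note wa = assms(4)[unfolded assms(2)]
  have "limits_interchange D"
    using assms(3) unfolding assms(2)
  proof
    assume "arens_regular (dual (algebra_of scl)) (algebra_of scl) (dual (algebra_of scl))
      (arens_adjoint (algebra_of scl) (mul (algebra_of scl)))"
    then show ?thesis by (rule limits_interchange_if_adjoint_regular[OF _ wa D])
  next
    assume "\<forall>D. derivation (algebra_of scl) D \<longrightarrow>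
      weakly_compact (algebra_of scl) (dual (algebra_of scl)) D"
    then show ?thesis
      using D by (intro limits_interchange_if_swap weakly_compact_swap derivation_bilinear) auto
  qed
  then show "inner_derivation A D"
    unfolding assms(2) by (rule inner_derivation_if_limits_interchange[OF D _ wa])
qed

end
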